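(* Let $(M,d)$ be a proper geodesic hyperbolic metric space such that $G=\mathrm{Isom}(M)$ acts cocompactly on $M$, and let $o\in M$. Consider a sequence of non-elementary probability measures $(\mu_m)_{m\in\mathbb{N}}$ on $G$ with bounded supports $S_m$ such that $$\limsup_{m\to\infty}\inf_{r\in[0,1)}\|\lambda_G((\mu_m)_{r,\mathrm{lazy}})\|_2<1\qquad\text{and}\qquad\sup_{m\in\mathbb{N}}\kappa_{S_m}<\infty.$$ Suppose that $\mu_m$ converges weakly to some probability measure $\mu_\infty$. Then, as $m\to\infty$, $$\ell(\mu_m)\to\ell(\mu_\infty).$$
   Context: $M$ is hyperbolic if for some $\delta\ge0$, $(x|y)_o\geq\min\{(x|z)_o,(z|y)_o\}-\delta$ for all $x,y,z,o\in M$, where $(x|y)_o=\frac12(d(x,o)+d(y,o)-d(x,y))$. An isometry $\gamma$ is loxodromic if $(\gamma^nx)_{n\in\mathbb{Z}}$ is a quasi-geodesic for any $x \in M$; it then fixes exactly two points of the Gromov boundary; two loxodromic elements are independent if their fixed point pairs are disjoint. A probability measure is non-elementary if the semigroup generated by its support contains two independent loxodromic elements. $\kappa(g)=d(go,o)$; $\kappa_S=\sup_{g\in S}\kappa(g)$ and $S$ is bounded if $\kappa_S<\infty$; $\mu_{r,\mathrm{lazy}}=r\delta_{\mathrm{id}}+(1-r)\mu$; $\lambda_G(\mu)$ is the image of $\mu$ under the left-regular representation on $L^2(G)$ (Haar measure on the locally compact group $G$), with operator norm $\|\cdot\|_2$. The drift $\ell(\mu)$ is the a.s. limit of $\frac1n\kappa(X_1\cdots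 X_n)$ for $(X_i)$ i.i.d. with law $\mu$. *)

theory Defs
  imports "HOL-Probability.Probability"
begin

section \<open>Metric spaces: proper, geodesic, Gromov hyperbolic\<close>

text \<open>The space \<open>M\<close> is the carrier of a type of class \<open>metric_space\<close>; each predicate below
  therefore takes the type as its argument.\<close>

definition proper_metric :: "'a::metric_space itself \<Rightarrow> bool"
  where "proper_metric (_ :: 'a itself) \<longleftrightarrow> (\<forall>(x::'a) r. compact (cball x r))"

definition geodesic_metric :: "'a::metric_space itself \<Rightarrow> bool"
  where "geodesic_metric (_ :: 'a itself) \<longleftrightarrow>
    (\<forall>x y :: 'a. \<exists>c :: real \<Rightarrow> 'a. c 0 = x \<and> c (dist x y) = y \<and>
       (\<forall>s\<in>{0..dist x y}. \<forall>t\<in>{0..dist x y}. dist (c s) (c t) = \<bar>s - t\<bar>))"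

definition gromov_product :: "'a::metric_space \<Rightarrow> 'a \<Rightarrow> 'a \<Rightarrow> real"
  where "gromov_product p x y = (dist x p + dist y p - dist x y) / 2"

definition gromov_hyperbolic :: "'a::metric_space itself \<Rightarrow> bool"
  where "gromov_hyperbolic (_ :: 'a itself) \<longleftrightarrow>
    (\<exists>\<delta>\<ge>0. \<forall>x y z p :: 'a.
       gromov_product p x y \<ge> min (gromov_product p x z) (gromov_product p z y) - \<delta>)"

section \<open>The Gromov boundary\<close>

text \<open>Sequences converging to infinity, modulo \<open>(x\<^sub>i|y\<^sub>j)\<^sub>p \<longrightarrow> \<infinity>\<close>.  For hyperbolic spaces this is an
  equivalence relation, and changing the base point \<open>p\<close> does not affect it because it changes
  Gromov products by a bounded amount only.\<close>

definition converges_to_infinity :: "'a::metric_space \<Rightarrow> (nat \<Rightarrow> 'a) \<Rightarrow> bool"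
  where "converges_to_infinity p x \<longleftrightarrow>
    filterlim (\<lambda>(i, j). gromov_product p (x i) (x j)) at_top (sequentially \<times>\<^sub>F sequentially)"

definition same_limit_rel :: "'a::metric_space \<Rightarrow> ((nat \<Rightarrow> 'a) \<times> (nat \<Rightarrow> 'a)) set"
  where "same_limit_rel p =
    {(x, y). converges_to_infinity p x \<and> converges_to_infinity p y \<and>
       filterlim (\<lambda>(i, j). gromov_product p (x i) (y j)) at_top (sequentially \<times>\<^sub>F sequentially)}"

definition gromov_boundary :: "'a::metric_space \<Rightarrow> (nat \<Rightarrow> 'a) set set"
  where "gromov_boundary p = {x. converges_to_infinity p x} // same_limit_rel p"

section \<open>The isometry group\<close>

typedef (overloaded) 'a isom =
    "{f :: 'a::metric_space \<Rightarrow> 'a. bij f \<and> (\<forall>x y. dist (f x) (f y) = dist x y)}"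
  morphisms app_isom Abs_isom
  by (rule exI[of _ id]) simp

setup_lifting type_definition_isom

instantiation isom :: (metric_space) "{monoid_mult, inverse}"
begin

lift_definition one_isom :: "'a isom" is id
  by simp

lift_definition times_isom :: "'a isom \<Rightarrow> 'a isom \<Rightarrow> 'a isom" is "(\<circ>)"
  by (simp add: bij_comp)

lift_definition inverse_isom :: "'a isom \<Rightarrow> 'a isom" is inv
  by (metis bij_imp_bij_inv bij_inv_eq_iff)

definition divide_isom :: "'a isom \<Rightarrow> 'a isom \<Rightarrow> 'a isom"
  where "divide_isom g h = g * inverse h"

instance
  by standard (transfer; simp add: comp_assoc)+

end

text \<open>The compact-open topology.\<close>

instantiation isom :: (metric_space) topological_space
begin

definition open_isom :: "'a isom set \<Rightarrow> bool"
  where "open_isom = generate_topology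
    {{g. app_isom g ` K \<subseteq> U} | K U. compact K \<and> open U}"

instance
  by standard (auto simp: open_isom_def intro: generate_topology.intros)

end

definition isom_cocompact :: "'a::metric_space itself \<Rightarrow> bool"
  where "isom_cocompact (_ :: 'a itself) \<longleftrightarrow>
    (\<exists>K :: 'a set. compact K \<and> (\<Union>g. app_isom g ` K) = UNIV)"

definition quasi_geodesic :: "(int \<Rightarrow> 'a::metric_space) \<Rightarrow> bool"
  where "quasi_geodesic x \<longleftrightarrow>
    (\<exists>K\<ge>1. \<exists>C\<ge>0. \<forall>i j. \<bar>real_of_int i - real_of_int j\<bar> / K - C \<le> dist (x i) (x j) \<and>
       dist (x i) (x j) \<le> K * \<bar>real_of_int i - real_of_int j\<bar> + C)"

definition loxodromic :: "'a::metric_space isom \<Rightarrow> bool"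
  where "loxodromic g \<longleftrightarrow> (\<forall>x. quasi_geodesic (\<lambda>n. app_isom (g powi n) x))"

definition boundary_action :: "'a::metric_space isom \<Rightarrow> (nat \<Rightarrow> 'a) set \<Rightarrow> (nat \<Rightarrow> 'a) set"
  where "boundary_action g \<xi> = (\<lambda>x. app_isom g \<circ> x) ` \<xi>"

definition boundary_fixed_points :: "'a::metric_space \<Rightarrow> 'a isom \<Rightarrow> (nat \<Rightarrow> 'a) set set"
  where "boundary_fixed_points p g = {\<xi> \<in> gromov_boundary p. boundary_action g \<xi> = \<xi>}"

definition independent_loxodromic :: "'a::metric_space \<Rightarrow> 'a isom \<Rightarrow> 'a isom \<Rightarrow> bool"
  where "independent_loxodromic p g h \<longleftrightarrow> loxodromic g \<and> loxodromic h \<and>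
    boundary_fixed_points p g \<inter> boundary_fixed_points p h = {}"

section \<open>Probability measures on the isometry group\<close>

definition borel_prob :: "'b::topological_space measure \<Rightarrow> bool"
  where "borel_prob \<mu> \<longleftrightarrow> prob_space \<mu> \<and> sets \<mu> = sets borel"

definition measure_support :: "'b::topological_space measure \<Rightarrow> 'b set"
  where "measure_support \<mu> = {x. \<forall>U. open U \<and> x \<in> U \<longrightarrow> emeasure \<mu> U > 0}"

definition weakly_converges ::
    "(nat \<Rightarrow> 'b::topological_space measure) \<Rightarrow> 'b measure \<Rightarrow> bool"
  where "weakly_converges \<mu> \<nu> \<longleftrightarrow>
    (\<forall>f :: 'b \<Rightarrow> real. continuous_on UNIV f \<and> bounded (range f) \<longrightarrow>
       (\<lambda>m. integral\<^sup>L (\<mu> m) f) \<longlonglongrightarrow> integral\<^sup>L \<nu> f)"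

inductive_set generated_semigroup :: "'b::semigroup_mult set \<Rightarrow> 'b set" for S where
  base: "g \<in> S \<Longrightarrow> g \<in> generated_semigroup S"
| mult: "g \<in> generated_semigroup S \<Longrightarrow> h \<in> generated_semigroup S \<Longrightarrow> g * h \<in> generated_semigroup S"

definition non_elementary :: "'a::metric_space \<Rightarrow> 'a isom measure \<Rightarrow> bool"
  where "non_elementary p \<mu> \<longleftrightarrow>
    (\<exists>g \<in> generated_semigroup (measure_support \<mu>).
     \<exists>h \<in> generated_semigroup (measure_support \<mu>). independent_loxodromic p g h)"

definition displacement :: "'a::metric_space \<Rightarrow> 'a isom \<Rightarrow> real"
  where "displacement p g = dist (app_isom g p) p"

definition displacement_sup :: "'a::metric_space \<Rightarrow> 'a isom set \<Rightarrow> ereal"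
  where "displacement_sup p S = (SUP g\<in>S. ereal (displacement p g))"

text \<open>\<open>r \<delta>\<^sub>i\<^sub>d + (1 - r) \<mu>\<close>\<close>

definition lazy :: "real \<Rightarrow> 'a::metric_space isom measure \<Rightarrow> 'a isom measure"
  where "lazy r \<mu> = measure_of UNIV (sets borel)
    (\<lambda>A. ennreal r * emeasure (return borel 1) A + ennreal (1 - r) * emeasure \<mu> A)"

text \<open>The drift is the almost sure limit, along an i.i.d. sequence \<open>\<omega> 0, \<omega> 1, \<dots>\<close> of law \<open>\<mu>\<close>
  (realised canonically on the product space).\<close>

definition drift :: "'a::metric_space \<Rightarrow> 'a isom measure \<Rightarrow> real"
  where "drift p \<mu> = (THE l. AE \<omega> in PiM UNIV (\<lambda>_::nat. \<mu>).
    (\<lambda>n. displacement p (prod_list (map \<omega> [0..<n])) / real n) \<longlonglongrightarrow> l)"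

section \<open>Haar measure and the left-regular representation\<close>

text \<open>Regularity is not required: when the space is proper, the isometry group is locally compact
  and second countable, where Borel measures that are finite on compact sets are regular.\<close>

definition left_haar_measure :: "'a::metric_space isom measure \<Rightarrow> bool"
  where "left_haar_measure \<nu> \<longleftrightarrow> sets \<nu> = sets borel \<and>
    (\<forall>g. \<forall>A\<in>sets borel. emeasure \<nu> ((*) g ` A) = emeasure \<nu> A) \<and>
    (\<forall>K. compact K \<longrightarrow> emeasure \<nu> K < \<infinity>) \<and>
    emeasure \<nu> UNIV \<noteq> 0"

definition square_integrable :: "'b measure \<Rightarrow> ('b \<Rightarrow> complex) \<Rightarrow> bool"
  where "square_integrable \<nu> f \<longleftrightarrow>
    f \<in> borel_measurable \<nu> \<and> integrable \<nu> (\<lambda>x. (cmod (f x))\<^sup>2)"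

definition L2_norm :: "'b measure \<Rightarrow> ('b \<Rightarrow> complex) \<Rightarrow> real"
  where "L2_norm \<nu> f = sqrt (\<integral>x. (cmod (f x))\<^sup>2 \<partial>\<nu>)"

definition left_regular :: "'a::metric_space isom \<Rightarrow> ('a isom \<Rightarrow> complex) \<Rightarrow> 'a isom \<Rightarrow> complex"
  where "left_regular g f = (\<lambda>h. f (inverse g * h))"

text \<open>\<open>\<lambda>\<^sub>G(\<mu>) = \<integral> \<lambda>\<^sub>G(g) d\<mu>(g)\<close>, on representatives of \<open>L\<^sup>2\<close> classes: for square-integrable \<open>f\<close> the
  integral below converges for almost every \<open>h\<close>.\<close>

definition left_regular_measure ::
    "'a::metric_space isom measure \<Rightarrow> ('a isom \<Rightarrow> complex) \<Rightarrow> 'a isom \<Rightarrow> complex"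
  where "left_regular_measure \<mu> f = (\<lambda>h. \<integral>g. left_regular g f h \<partial>\<mu>)"

text \<open>For a probability measure \<open>\<mu>\<close> the set below is bounded by 1 (Minkowski).\<close>

definition left_regular_norm :: "'a::metric_space isom measure \<Rightarrow> 'a isom measure \<Rightarrow> real"
  where "left_regular_norm \<nu> \<mu> =
    (SUP f\<in>{f. square_integrable \<nu> f \<and> L2_norm \<nu> f \<le> 1}. L2_norm \<nu> (left_regular_measure \<mu> f))"

end

theory Submission
  imports Defs "HOL-Real_Asymp.Real_Asymp"
begin

text \<open>Write \<open>X\<^sub>n\<close> for the product of the first \<open>n\<close> increments and \<open>o\<close> for the base point.  The mean
  \<open>a\<^sub>n\<close> of \<open>\<kappa>(X\<^sub>n)\<close> is continuous in the measure because Markov averages of 1-Lipschitz functions on \<open>M\<close>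
  are again 1-Lipschitz, so the point is to approximate the drift by \<open>a\<^sub>n / n\<close> uniformly in the measure.
  As \<open>d(X\<^sub>n o, x) - d(x, o) = \<kappa>(X\<^sub>n) - 2 (x|X\<^sub>n o)\<^sub>o\<close> is a cocycle, its exponential moments are
  submultiplicative uniformly in \<open>x\<close>; hence a bound \<open>\<eta>\<^sub>n\<close> on the means of \<open>(x|X\<^sub>n o)\<^sub>o\<close> that is \<open>o(n)\<close> and
  uniform in \<open>x\<close> yields almost sure convergence and
  \<open>(a\<^sub>n - 2 \<eta>\<^sub>n) / n \<le> \<ell> \<le> a\<^sub>n / n\<close>.

  For \<open>n = 2\<^sup>k\<close>, if \<open>(x|X\<^sub>n o)\<^sub>o \<ge> k\<^sup>2\<close> then hyperbolicity forces the path \<open>o, X\<^sub>1 o, \<dots>, X\<^sub>n o\<close> to pass within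
  \<open>O(k)\<close> of the point of \<open>[o, x]\<close> at distance \<open>k\<^sup>2\<close> from \<open>o\<close>.  The spectral gap of the lazy walk bounds the
  probability of visiting that ball at time \<open>i\<close> by \<open>\<rho>\<^sup>i\<close> times a quantity exponential in \<open>k\<close>; visits
  need \<open>i \<ge> c k\<^sup>2\<close>, and the Green functions of \<open>\<mu>\<close> and of its lazy version are proportional, so the
  probability tends to \<open>0\<close>.  The estimate on \<open>(x|X\<^sub>n o)\<^sub>o\<close> passes to the weak limit.\<close>


section \<open>The isometry group of a proper space\<close>

text \<open>The laziness parameter in the hypothesis may depend on \<open>m\<close> and approach 1,
  so no estimate may contain \<open>r\<close>: the comparison of Green functions costs only the
  factor \<open>1 - r\<close>, which is at most 1. Times \<open>2 ^ k\<close> are natural because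
  chaining the four-point inequality along n steps loses \<delta> times the binary logarithm of n.
  The threshold k^2 meets two demands: it outgrows every linear function of k, so that decay of
  order exp (- q k^2) beats volume factors exponential in k, and it is o(2^k), as it enters the
  bound on the mean. The spectral gap is given along the sequence only, so for the limit measure the
  bound on the mean Gromov product has to be inherited time by time before its drift can be
  estimated. Since \<open>drift\<close> is a definite description, almost sure convergence must be
  established for each measure whose drift is used; two-sided exponential tail bounds yield
  existence and value of the limit together, the value being the infimum of a_n / n over powers of
  2.\<close>

lemma app_isom_1 [simp]: "app_isom 1 x = x"
  by transfer simp

lemma app_isom_mult [simp]: "app_isom (g * h) x = app_isom g (app_isom h x)"
  by transfer simp

lemma dist_app_isom [simp]: "dist (app_isom g x) (app_isom g y) = dist x y"
  by transfer simp

lemma app_isom_inverse_cancel [simp]: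
  "app_isom (inverse g) (app_isom g x) = x" "app_isom g (app_isom (inverse g) x) = x"
  by (transfer; simp add: bij_is_inj bij_is_surj surj_f_inv_f)+

lemma isom_eqI: "(\<And>x. app_isom g x = app_isom h x) \<Longrightarrow> g = h"
  by transfer auto

lemma isom_inverse_inverse [simp]: "inverse (inverse g) = (g :: 'a::metric_space isom)"
  using app_isom_inverse_cancel(1)[of "inverse g" "app_isom g x" for x]
  by (intro isom_eqI) simp

lemma isom_mult_inverse_cancel [simp]:
  "g * (inverse g * h) = h" "inverse g * (g * h) = (h :: 'a::metric_space isom)"
  by (rule isom_eqI; simp)+

lemma isom_inverse_distrib: "inverse (g * h) = inverse h * inverse (g :: 'a::metric_space isom)"
proof (rule isom_eqI)
  fix x
  have "app_isom (inverse h * inverse g) x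
      = app_isom (inverse (g * h)) (app_isom (g * h) (app_isom (inverse h * inverse g) x))"
    by (rule app_isom_inverse_cancel(1)[symmetric])
  then show "app_isom (inverse (g * h)) x = app_isom (inverse h * inverse g) x" by simp
qed

lemma isom_inverse_one [simp]: "inverse 1 = (1 :: 'a::metric_space isom)"
  using app_isom_inverse_cancel(1)[of 1] by (intro isom_eqI) simp

lemma dist_inverse_isom: "dist (app_isom (inverse g) x) y = dist x (app_isom g y)"
  using dist_app_isom[of g "app_isom (inverse g) x" y] by simp

lemma displacement_nonneg [simp]: "0 \<le> displacement p g"
  by (simp add: displacement_def)

lemma displacement_one [simp]: "displacement p 1 = 0"
  by (simp add: displacement_def)

lemma displacement_inverse [simp]: "displacement p (inverse g) = displacement p g"
  unfolding displacement_def dist_inverse_isom by (rule dist_commute)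

lemma displacement_mult_le: "displacement p (g * h) \<le> displacement p g + displacement p h"
  unfolding displacement_def
  using dist_triangle[of "app_isom g (app_isom h p)" p "app_isom g p"] by simp

section \<open>The compact-open topology as the topology of pointwise convergence\<close>

lemma open_isom_basic:
  fixes K U :: "'a::metric_space set"
  assumes "compact K" "open U"
  shows "open {g. app_isom g ` K \<subseteq> U}"
  unfolding open_isom_def using assms by (intro generate_topology.Basis) blast

lemma continuous_on_app_isom: "continuous_on A (\<lambda>g. app_isom g x)"
proof (rule continuous_on_subset[of UNIV])
  show "continuous_on UNIV (\<lambda>g. app_isom g x)"
    unfolding continuous_on_open_vimage[OF open_UNIV]
    using open_isom_basic[of "{x}"] by (simp add: vimage_def)
qed simp

lemma continuous_on_app_isom_compose [continuous_intros]:
  "continuous_on A f \<Longrightarrow> continuous_on A (\<lambda>z. app_isom (f z) x)"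
  by (rule continuous_on_compose2[OF continuous_on_app_isom[of UNIV x]]) simp_all

text \<open>Isometries are equicontinuous, so closeness on a finite e/3-net of \<open>K\<close>
  forces closeness within e on all of \<open>K\<close>. Hence the compact-open topology is no finer
  than pointwise convergence.\<close>

lemma open_isom_pointwise:
  fixes g :: "'a::metric_space isom"
  assumes "open W" "g \<in> W"
  shows "\<exists>F e. finite F \<and> e > (0::real) \<and>
    (\<forall>h. (\<forall>x\<in>F. dist (app_isom h x) (app_isom g x) < e) \<longrightarrow> h \<in> W)"
proof -
  let ?P = "\<lambda>W. \<exists>F e. finite F \<and> e > (0::real) \<and>
      (\<forall>h. (\<forall>x\<in>F. dist (app_isom h x) (app_isom g x) < e) \<longrightarrow> h \<in> W)"
  have "generate_topology {{g. app_isom g ` K \<subseteq> U} | K U. compact K \<and> open U} W"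
    using assms(1) by (simp add: open_isom_def)
  then have "g \<in> W \<longrightarrow> ?P W"
  proof (induction rule: generate_topology.induct)
    case UNIV
    have "?P UNIV" by (rule exI[of _ "{}"], rule exI[of _ 1]) simp
    then show ?case by blast
  next
    case (Int a b)
    show ?case
    proof
      assume "g \<in> a \<inter> b"
      then obtain F1 e1 F2 e2 where
        1: "finite F1" "e1 > (0::real)"
          "\<And>h. (\<forall>x\<in>F1. dist (app_isom h x) (app_isom g x) < e1) \<Longrightarrow> h \<in> a"
        and 2: "finite F2" "e2 > (0::real)"
          "\<And>h. (\<forall>x\<in>F2. dist (app_isom h x) (app_isom g x) < e2) \<Longrightarrow> h \<in> b"
        using Int.IH by auto
      show "?P (a \<inter> b)"
        using 1(1,2) 2(1,2) by (intro exI[of _ "F1 \<union> F2"] exI[of _ "min e1 e2"])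
          (simp add: 1(3) 2(3))
    qed
  next
    case (UN K)
    show ?case
    proof
      assume "g \<in> \<Union>K"
      then obtain k where k: "k \<in> K" "g \<in> k" by auto
      have "?P k" using UN.IH[OF k(1)] k(2) by (rule mp)
      then obtain F e where "finite F" "e > (0::real)"
        "\<forall>h. (\<forall>x\<in>F. dist (app_isom h x) (app_isom g x) < e) \<longrightarrow> h \<in> k" by blast
      with k(1) show "?P (\<Union>K)" by blast
    qed
  next
    case (Basis s)
    then obtain K U where s: "s = {g. app_isom g ` K \<subseteq> U}" and K: "compact K" and U: "open U"
      by auto
    show ?case
    proof
      assume "g \<in> s"
      then have sub: "app_isom g ` K \<subseteq> U" by (simp add: s)
      have cg: "continuous_on K (app_isom g)"
        by (auto simp: continuous_on_iff)
      obtain e where e: "e > 0" and eU: "(\<Union>x\<in>app_isom g ` K. ball x e) \<subseteq> U"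
        using compact_subset_open_imp_ball_epsilon_subset[OF compact_continuous_image[OF cg K] U sub]
        by auto
      obtain F where F: "finite F" "K \<subseteq> (\<Union>x\<in>F. ball x (e/3))"
        using compact_eq_totally_bounded[THEN iffD1, OF K, THEN conjunct2, rule_format, of "e/3"] e
        by auto
      have "h \<in> s" if h: "\<forall>x\<in>F. dist (app_isom h x) (app_isom g x) < e/3" for h
      proof -
        have "app_isom h z \<in> U" if z: "z \<in> K" for z
        proof -
          obtain x where x: "x \<in> F" "dist x z < e/3" using F z by auto
          have "dist (app_isom g z) (app_isom h z)
              \<le> dist (app_isom g z) (app_isom g x) + dist (app_isom g x) (app_isom h x)
                + dist (app_isom h x) (app_isom h z)"
            using dist_triangle[of "app_isom g z" "app_isom h z" "app_isom g x"]
              dist_triangle[of "app_isom g x" "app_isom h z" "app_isom h x"] by linarith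
          also have "\<dots> < e/3 + e/3 + e/3"
            using x bspec[OF h x(1)] by (intro add_strict_mono) (simp_all add: dist_commute)
          finally have "app_isom h z \<in> ball (app_isom g z) e" by simp
          then show ?thesis using eU z by blast
        qed
        then show ?thesis unfolding s by blast
      qed
      moreover have "e/3 > 0" using e by simp
      ultimately show "?P s" using F(1) by blast
    qed
  qed
  then show ?thesis using assms(2) by (rule mp)
qed

section \<open>A countable base and Borel measurability\<close>

lemma proper_countable_dense:
  assumes "proper_metric TYPE('a::metric_space)"
  obtains D :: "'a::metric_space set" where "countable D" "\<And>x e. e > 0 \<Longrightarrow> \<exists>z\<in>D. dist x z < e"
proof -
  obtain p :: 'a where True by auto
  have "\<exists>F. finite F \<and> cball p (real n) \<subseteq> (\<Union>x\<in>F. ball x (1 / Suc m))" for n m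
    using assms compact_eq_totally_bounded[of "cball p (real n)"] unfolding proper_metric_def
    by (meson of_nat_0_less_iff zero_less_Suc zero_less_divide_1_iff)
  then obtain F where F: "\<And>n m. finite (F n m)"
    "\<And>n m. cball p (real n) \<subseteq> (\<Union>x\<in>F n m. ball x (1 / Suc m))" by metis
  show thesis
  proof (rule that[of "\<Union>n m. F n m"])
    show "countable (\<Union>n m. F n m)"
      using F(1) by (intro countable_UN countableI_type countable_finite)
    fix x :: 'a and e :: real assume "e > 0"
    then obtain m where m: "1 / real (Suc m) < e"
      using nat_approx_posE by auto
    obtain n where "dist p x \<le> real n" using real_arch_simple by blast
    then have "x \<in> (\<Union>x\<in>F n m. ball x (1 / Suc m))"
      using F(2)[of n m] by (meson mem_cball subsetD)
    then show "\<exists>z\<in>\<Union>n m. F n m. dist x z < e"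
      using m by (auto simp: dist_commute[of x] intro: less_trans simp del: of_nat_Suc)
  qed
qed

text \<open>A basic open set is coded by a finite list of constraints, so that letting centres range
  over a countable dense set and radii over the rationals leaves only countably many codes.\<close>

definition isom_base :: "('a \<times> 'a \<times> real) list \<Rightarrow> 'a::metric_space isom set"
  where "isom_base L = {h. \<forall>(x, c, q)\<in>set L. dist (app_isom h x) c < q}"

lemma open_isom_base: "open (isom_base L)"
proof -
  have "isom_base L = (\<Inter>(x, c, q)\<in>set L. {h. dist (app_isom h x) c < q})"
    by (auto simp: isom_base_def)
  also have "open \<dots>"
    by (intro open_INT ballI) (auto intro!: open_Collect_less continuous_intros)
  finally show ?thesis .
qed

text \<open>Second countability in usable form: by \<open>open_isom_pointwise\<close> only finitely
  many points matter, and these and their images can be moved into the dense set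
  \<open>D\<close>.\<close>

lemma open_isom_eq_UN_base:
  fixes W :: "'a::metric_space isom set"
  assumes D: "\<And>x e. e > 0 \<Longrightarrow> \<exists>z\<in>D. dist x z < e" and W: "open W"
  shows "W = (\<Union>L\<in>{L \<in> lists (D \<times> D \<times> \<rat>). isom_base L \<subseteq> W}. isom_base L)"
proof (intro equalityI subsetI)
  fix g assume "g \<in> W"
  obtain F e where F: "finite F" "e > (0::real)"
    and FW: "\<forall>h. (\<forall>x\<in>F. dist (app_isom h x) (app_isom g x) < e) \<longrightarrow> h \<in> W"
    using open_isom_pointwise[OF W \<open>g \<in> W\<close>] by (elim exE conjE)
  have e6: "e / 6 > 0" using F by simp
  \<comment> \<open>Above e/6 so that \<open>g\<close> itself satisfies the constraints, below e/2
    so that \<open>q\<close> plus three errors of e/6 stays within e.\<close>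
  obtain q where q: "q \<in> \<rat>" "e/6 < q" "q < e/2"
    using Rats_dense_in_real[of "e/6" "e/2"] F by auto
  obtain near where near: "\<And>x. near x \<in> D" "\<And>x. dist x (near x) < e/6"
    using D[OF e6] by metis
  define c where "c x = near (app_isom g (near x))" for x
  have c: "c x \<in> D" "dist (app_isom g (near x)) (c x) < e/6" for x
    using near by (auto simp only: c_def)
  obtain xs where xs: "set xs = F" using F(1) finite_list by blast
  define L where "L = map (\<lambda>x. (near x, c x, q)) xs"
  have setL: "set L = (\<lambda>x. (near x, c x, q)) ` F" by (simp add: L_def xs)
  have "dist (app_isom g (near x)) (c x) < q" for x using c(2)[of x] q(2) by simp
  then have "g \<in> isom_base L" unfolding isom_base_def setL by auto
  moreover have "isom_base L \<subseteq> W"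
  proof
    fix h assume "h \<in> isom_base L"
    then have h: "x \<in> F \<Longrightarrow> dist (app_isom h (near x)) (c x) < q" for x
      by (auto simp: isom_base_def setL)
    show "h \<in> W"
    proof (rule FW[rule_format])
      fix x assume "x \<in> F"
      have "dist (app_isom h x) (app_isom g x) \<le> dist (app_isom h x) (app_isom h (near x))
          + dist (app_isom h (near x)) (c x) + dist (c x) (app_isom g (near x))
          + dist (app_isom g (near x)) (app_isom g x)"
        using dist_triangle[of "app_isom h x" "app_isom g x" "app_isom h (near x)"]
          dist_triangle[of "app_isom h (near x)" "app_isom g x" "c x"]
          dist_triangle[of "c x" "app_isom g x" "app_isom g (near x)"] by linarith
      also have "\<dots> < e/6 + q + e/6 + e/6"
        using near(2)[of x] c(2)[of x] h[OF \<open>x \<in> F\<close>]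
        by (intro add_strict_mono) (auto simp: dist_commute)
      also have "\<dots> \<le> e" using q by simp
      finally show "dist (app_isom h x) (app_isom g x) < e" .
    qed
  qed
  moreover have "L \<in> lists (D \<times> D \<times> \<rat>)"
    using near(1) c(1) q(1) by (auto simp: L_def)
  ultimately show "g \<in> (\<Union>L\<in>{L \<in> lists (D \<times> D \<times> \<rat>). isom_base L \<subseteq> W}. isom_base L)"
    by blast
qed blast

lemma countable_isom_base_lists:
  "countable D \<Longrightarrow> countable (lists (D \<times> D \<times> (\<rat> :: real set)))"
  by (intro countable_lists countable_SIGMA countable_rat)

text \<open>By the countable base, the Borel sets of the group are generated by the real functions
  measuring the distance from an image point to a fixed point; measurability questions thereby
  become real-valued ones.\<close>

lemma measurable_isomI:
  fixes f :: "'b \<Rightarrow> 'a::metric_space isom"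
  assumes pm: "proper_metric TYPE('a)"
    and f: "\<And>x y. (\<lambda>w. dist (app_isom (f w) x) y) \<in> borel_measurable M"
  shows "f \<in> M \<rightarrow>\<^sub>M borel"
proof (rule borel_measurableI)
  fix W :: "'a isom set" assume W: "open W"
  obtain D :: "'a set" where D: "countable D" "\<And>x e. e > 0 \<Longrightarrow> \<exists>z\<in>D. dist x z < e"
    using proper_countable_dense[OF pm] by metis
  define I where "I = {L \<in> lists (D \<times> D \<times> (\<rat> :: real set)). isom_base L \<subseteq> W}"
  have "countable I"
    unfolding I_def by (rule countable_subset[OF _ countable_isom_base_lists[OF D(1)]]) blast
  have "f -` isom_base L \<inter> space M \<in> sets M" for L
  proof -
    have "f -` isom_base L \<inter> space M =
        {w\<in>space M. \<forall>z\<in>set L. dist (app_isom (f w) (fst z)) (fst (snd z)) < snd (snd z)}"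
      by (auto simp: isom_base_def case_prod_unfold)
    also have "\<dots> \<in> sets M"
      using f by (intro sets.sets_Collect_finite_All) auto
    finally show ?thesis .
  qed
  then have "(\<Union>L\<in>I. f -` isom_base L \<inter> space M) \<in> sets M"
    using \<open>countable I\<close> by (intro sets.countable_UN'') auto
  also have "(\<Union>L\<in>I. f -` isom_base L \<inter> space M) = f -` (\<Union>L\<in>I. isom_base L) \<inter> space M"
    by blast
  also have "(\<Union>L\<in>I. isom_base L) = W"
    unfolding I_def by (rule open_isom_eq_UN_base[OF D(2) W, symmetric])
  finally show "f -` W \<inter> space M \<in> sets M" .
qed

lemma borel_measurable_app_isom:
  assumes "f \<in> M \<rightarrow>\<^sub>M borel"
  shows "(\<lambda>w. dist (app_isom (f w) x) y) \<in> borel_measurable M"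
proof -
  have "(\<lambda>g. dist (app_isom g x) y) \<in> borel_measurable borel"
    by (intro borel_measurable_continuous_onI continuous_intros)
  from measurable_compose[OF assms this] show ?thesis .
qed

lemma borel_measurable_displacement [measurable]: "displacement p \<in> borel_measurable borel"
  unfolding displacement_def by (rule borel_measurable_app_isom) simp

lemma measurable_isom_mult:
  fixes f g :: "'b \<Rightarrow> 'a::metric_space isom"
  assumes pm: "proper_metric TYPE('a)" and f: "f \<in> M \<rightarrow>\<^sub>M borel" and g: "g \<in> M \<rightarrow>\<^sub>M borel"
  shows "(\<lambda>w. f w * g w) \<in> M \<rightarrow>\<^sub>M borel"
proof (rule measurable_isomI[OF pm])
  fix x y :: 'a
  obtain D :: "'a set" where D: "countable D" "\<And>x e. e > 0 \<Longrightarrow> \<exists>z\<in>D. dist x z < e"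
    using proper_countable_dense[OF pm] by metis
  note [measurable] = borel_measurable_app_isom[OF f] borel_measurable_app_isom[OF g]
  show "(\<lambda>w. dist (app_isom (f w * g w) x) y) \<in> borel_measurable M"
    unfolding borel_measurable_iff_less
  proof
    fix q :: real
    \<comment> \<open>The composition is untangled by an infimum over dense intermediate points
      \<open>z\<close>: each term involves \<open>f\<close> and \<open>g\<close> separately, and
      approximating \<open>app_isom (g w) x\<close> by \<open>z\<close> costs its error
      twice.\<close>
    have "{w \<in> space M. dist (app_isom (f w * g w) x) y < q} =
      (\<Union>z\<in>D. {w \<in> space M. dist (app_isom (g w) x) z + dist (app_isom (f w) z) y < q})"
    proof (intro equalityI subsetI)
      fix w assume "w \<in> {w \<in> space M. dist (app_isom (f w * g w) x) y < q}"
      then have w: "w \<in> space M" "dist (app_isom (f w) (app_isom (g w) x)) y < q" by auto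
      define e where "e = (q - dist (app_isom (f w) (app_isom (g w) x)) y) / 2"
      have "e > 0" using w by (simp add: e_def)
      then obtain z where z: "z \<in> D" "dist (app_isom (g w) x) z < e" using D(2) by metis
      have "dist (app_isom (f w) z) y \<le> dist (app_isom (g w) x) z
          + dist (app_isom (f w) (app_isom (g w) x)) y"
        by (metis dist_app_isom dist_commute dist_triangle)
      then have "dist (app_isom (g w) x) z + dist (app_isom (f w) z) y
          < 2 * e + dist (app_isom (f w) (app_isom (g w) x)) y" using z by linarith
      also have "\<dots> = q" by (simp add: e_def field_simps)
      finally show "w \<in> (\<Union>z\<in>D. {w \<in> space M. dist (app_isom (g w) x) z + dist (app_isom (f w) z) y < q})"
        using w z by auto
    next
      fix w assume "w \<in> (\<Union>z\<in>D. {w \<in> space M. dist (app_isom (g w) x) z + dist (app_isom (f w) z) y < q})"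
      then obtain z where "w \<in> space M" "dist (app_isom (g w) x) z + dist (app_isom (f w) z) y < q"
        by auto
      moreover have "dist (app_isom (f w) (app_isom (g w) x)) y \<le> dist (app_isom (g w) x) z + dist (app_isom (f w) z) y"
        by (metis dist_app_isom dist_triangle)
      ultimately show "w \<in> {w \<in> space M. dist (app_isom (f w * g w) x) y < q}" by auto
    qed
    also have "\<dots> \<in> sets M" using D(1) by (intro sets.countable_UN'') auto
    finally show "{w \<in> space M. dist (app_isom (f w * g w) x) y < q} \<in> sets M" .
  qed
qed

lemma measurable_isom_inverse:
  fixes f :: "'b \<Rightarrow> 'a::metric_space isom"
  assumes "proper_metric TYPE('a)" and f: "f \<in> M \<rightarrow>\<^sub>M borel"
  shows "(\<lambda>w. inverse (f w)) \<in> M \<rightarrow>\<^sub>M borel"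
proof (rule measurable_isomI[OF assms(1)])
  fix x y :: 'a
  show "(\<lambda>w. dist (app_isom (inverse (f w)) x) y) \<in> borel_measurable M"
    using borel_measurable_app_isom[OF f, of y x] by (simp add: dist_inverse_isom dist_commute[of x])
qed

section \<open>Compactness of displacement balls\<close>

lemma continuous_on_fst_apply:
  "continuous_on A (\<lambda>z :: ('b \<Rightarrow> 'c::topological_space) \<times> 'd::topological_space. fst z x)"
  by (rule continuous_on_product_then_coordinatewise[OF continuous_on_fst[OF continuous_on_id]])

lemma continuous_on_snd_apply:
  "continuous_on A (\<lambda>z :: 'd::topological_space \<times> ('b \<Rightarrow> 'c::topological_space). snd z x)"
  by (rule continuous_on_product_then_coordinatewise[OF continuous_on_snd[OF continuous_on_id]])

lemma closed_adjoint_pairs: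
  "closed {z :: ('a::metric_space \<Rightarrow> 'a) \<times> ('a \<Rightarrow> 'a). \<forall>x y. dist (fst z x) y = dist x (snd z y)}"
  by (intro closed_Collect_all closed_Collect_eq continuous_on_dist continuous_on_const
      continuous_on_fst_apply continuous_on_snd_apply)

text \<open>Arzela-Ascoli through Tychonoff: on pairs of maps, being mutually inverse isometries is the
  pointwise closed condition \<open>dist (f x) y = dist x (g y)\<close>.\<close>

lemma compact_displacement_le:
  fixes p :: "'a::metric_space"
  assumes pm: "proper_metric TYPE('a)"
  shows "compact {g. displacement p g \<le> R}"
proof -
  \<comment> \<open>The radius is the bound that \<open>displacement p g \<le> R\<close> imposes on
    the image of \<open>x\<close>; at \<open>x = p\<close> it returns the displacement bound itself.
    The same radius serves the inverse, which has equal displacement.\<close>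
  let ?B = "PiE UNIV (\<lambda>x :: 'a. cball p (R + dist p x))"
  let ?C = "(?B \<times> ?B) \<inter> {z. \<forall>x y. dist (fst z x) y = dist x (snd z y)}"
  have "compactin (product_topology (\<lambda>_. euclidean) (UNIV::'a set)) ?B"
    using pm by (auto simp: compactin_PiE proper_metric_def)
  then have "compact ?B" by (simp add: euclidean_product_topology)
  then have C: "compact ?C"
    by (intro compact_Int_closed compact_Times closed_adjoint_pairs)
  have app: "app_isom (Abs_isom (fst z)) = fst z" if z: "z \<in> ?C" for z
  proof (rule Abs_isom_inverse)
    have adj: "dist (fst z x) y = dist x (snd z y)" for x y using z by blast
    \<comment> \<open>Evaluating adjointness where one of the two distances vanishes makes the two
      maps mutually inverse.\<close>
    have 1: "fst z (snd z x) = x" for x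
      using adj[of "snd z x" x] by (metis dist_self dist_eq_0_iff)
    have 2: "snd z (fst z x) = x" for x
      using adj[of x "fst z x"] by (metis dist_self dist_eq_0_iff)
    have "bij (fst z)" by (intro o_bij[of "snd z"]) (simp_all only: fun_eq_iff o_def id_def 1 2 simp_thms)
    moreover have "dist (fst z x) (fst z y) = dist x y" for x y
      using adj[of x "fst z y"] by (simp only: 2)
    ultimately show "fst z \<in> {f. bij f \<and> (\<forall>x y. dist (f x) (f y) = dist x y)}" by blast
  qed
  have "continuous_on ?C (\<lambda>z. Abs_isom (fst z))"
    unfolding continuous_on_topological
  proof (intro ballI allI impI)
    fix z W assume z: "z \<in> ?C" and W: "open W" "Abs_isom (fst z) \<in> W"
    obtain F e where F: "finite F" "e > (0::real)"
      "\<forall>h. (\<forall>x\<in>F. dist (app_isom h x) (app_isom (Abs_isom (fst z)) x) < e) \<longrightarrow> h \<in> W"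
      using open_isom_pointwise[OF W] by (elim exE conjE)
    let ?A = "\<Inter>x\<in>F. {w :: ('a \<Rightarrow> 'a) \<times> ('a \<Rightarrow> 'a). dist (fst w x) (fst z x) < e}"
    have "open ?A" using F(1)
      by (intro open_INT ballI open_Collect_less continuous_on_dist continuous_on_const
          continuous_on_fst_apply)
    moreover have "z \<in> ?A" using F by auto
    moreover have "Abs_isom (fst w) \<in> W" if "w \<in> ?C" "w \<in> ?A" for w
      using that F(3)[rule_format, of "Abs_isom (fst w)"] app[OF that(1)] app[OF z] by auto
    ultimately show "\<exists>A. open A \<and> z \<in> A \<and> (\<forall>y\<in>?C. y \<in> A \<longrightarrow> Abs_isom (fst y) \<in> W)"
      by (intro exI[of _ ?A] conjI ballI impI)
  qed
  then have "compact ((\<lambda>z. Abs_isom (fst z)) ` ?C)" by (rule compact_continuous_image[OF _ C])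
  also have "(\<lambda>z. Abs_isom (fst z)) ` ?C = {g. displacement p g \<le> R}"
  proof (intro equalityI subsetI)
    fix g assume "g \<in> (\<lambda>z. Abs_isom (fst z)) ` ?C"
    then obtain z where z: "z \<in> ?C" "g = Abs_isom (fst z)" by blast
    then have "fst z \<in> ?B" by (simp only: Int_iff mem_Times_iff)
    then have "fst z p \<in> cball p (R + dist p p)" by (rule PiE_mem) simp
    then show "g \<in> {g. displacement p g \<le> R}"
      by (simp add: z(2) displacement_def app[OF z(1)] dist_commute)
  next
    fix g assume "g \<in> {g. displacement p g \<le> R}"
    then have g: "dist p (app_isom g p) \<le> R" "dist p (app_isom (inverse g) p) \<le> R"
      using displacement_inverse[of p g] by (simp_all add: displacement_def dist_commute[of p])
    have *: "dist p (app_isom h x) \<le> R + dist p x" if "dist p (app_isom h p) \<le> R" for h x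
      using dist_triangle[of p "app_isom h x" "app_isom h p"] that by simp
    have "(app_isom g, app_isom (inverse g)) \<in> ?C"
      using *[OF g(1)] *[OF g(2)]
      using dist_inverse_isom[of "inverse g"] by (simp add: PiE_iff)
    then show "g \<in> (\<lambda>z. Abs_isom (fst z)) ` ?C"
      by (rule rev_image_eqI) (simp add: app_isom_inverse)
  qed
  finally show ?thesis .
qed

section \<open>Laws of the random walk\<close>

lemma measurable_prod_list_isom:
  fixes \<mu> :: "'a::metric_space isom measure"
  assumes pm: "proper_metric TYPE('a)" and \<mu>: "sets \<mu> = sets borel"
  shows "(\<lambda>\<omega>. prod_list (map \<omega> [0..<n])) \<in> PiM UNIV (\<lambda>_::nat. \<mu>) \<rightarrow>\<^sub>M borel"
proof (induction n)
  case (Suc n)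
  have "(\<lambda>\<omega>. \<omega> n) \<in> PiM UNIV (\<lambda>_::nat. \<mu>) \<rightarrow>\<^sub>M borel"
    using measurable_component_singleton[of n UNIV "\<lambda>_. \<mu>"] measurable_cong_sets[OF refl \<mu>] by blast
  from measurable_isom_mult[OF pm Suc this] show ?case by simp
qed simp

text \<open>The n-th convolution power of \<mu>, obtained as an image of the same product space on
  which \<open>drift\<close> is defined, so that pathwise statements and statements on laws
  translate directly.\<close>

definition walk_law :: "'a::metric_space isom measure \<Rightarrow> nat \<Rightarrow> 'a isom measure"
  where "walk_law \<mu> n = distr (PiM UNIV (\<lambda>_::nat. \<mu>)) borel (\<lambda>\<omega>. prod_list (map \<omega> [0..<n]))"

lemma sets_walk_law [simp, measurable_cong]: "sets (walk_law \<mu> n) = sets borel"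
  and space_walk_law [simp]: "space (walk_law \<mu> n) = UNIV"
  by (simp_all add: walk_law_def)

lemma borel_probD:
  assumes "borel_prob \<mu>"
  shows "prob_space \<mu>" "sets \<mu> = sets borel" "space \<mu> = UNIV"
  using assms sets_eq_imp_space_eq[of \<mu> borel] by (auto simp: borel_prob_def)

locale isom_walk =
  fixes \<mu> :: "'a::metric_space isom measure"
  assumes pm: "proper_metric TYPE('a)" and bp: "borel_prob \<mu>"
begin

sublocale M: prob_space \<mu> by (rule borel_probD[OF bp])

sublocale sequence_space \<mu> ..

lemma sets_mu [simp, measurable_cong]: "sets \<mu> = sets borel" and space_mu [simp]: "space \<mu> = UNIV"
  using borel_probD[OF bp] by auto

lemma measurable_partial_prod [measurable]:
  "(\<lambda>\<omega>. prod_list (map \<omega> [0..<n])) \<in> S \<rightarrow>\<^sub>M borel"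
  by (rule measurable_prod_list_isom[OF pm sets_mu])

sublocale L: prob_space "walk_law \<mu> n" for n
  unfolding walk_law_def by (rule prob_space_distr) measurable

lemma measurable_mult [measurable]:
  assumes "f \<in> M \<rightarrow>\<^sub>M borel" "g \<in> M \<rightarrow>\<^sub>M (borel :: 'a isom measure)"
  shows "(\<lambda>w. f w * g w) \<in> M \<rightarrow>\<^sub>M borel"
  using measurable_isom_mult[OF pm assms] .

lemma measurable_inverse [measurable]:
  assumes "f \<in> M \<rightarrow>\<^sub>M (borel :: 'a isom measure)"
  shows "(\<lambda>w. inverse (f w)) \<in> M \<rightarrow>\<^sub>M borel"
  using measurable_isom_inverse[OF pm assms] .

lemma walk_law_0: "walk_law \<mu> 0 = return borel 1"
proof -
  have "walk_law \<mu> 0 = distr S borel (\<lambda>_. 1)" by (simp add: walk_law_def)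
  also have "\<dots> = return borel 1" by (rule P.distr_const) simp
  finally show ?thesis .
qed

lemma walk_law_1: "walk_law \<mu> (Suc 0) = \<mu>"
proof -
  have "walk_law \<mu> (Suc 0) = distr S borel (\<lambda>\<omega>. \<omega> 0)" by (simp add: walk_law_def)
  also have "\<dots> = distr S \<mu> (\<lambda>\<omega>. \<omega> 0)" by (rule distr_cong) simp_all
  also have "\<dots> = \<mu>" by (rule PiM_component) simp
  finally show ?thesis .
qed

lemma prod_list_comb_seq:
  "prod_list (map (comb_seq n \<omega> \<omega>') [0..<n + k])
    = prod_list (map \<omega> [0..<n]) * prod_list (map \<omega>' [0..<k])"
proof -
  have "map (comb_seq n \<omega> \<omega>') [0..<n + k] = map \<omega> [0..<n] @ map \<omega>' [0..<k]"
    by (rule nth_equalityI) (auto simp: nth_append comb_seq_def)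
  then show ?thesis by simp
qed

text \<open>Independence of the first \<open>n\<close> and the next \<open>k\<close> increments: an
  i.i.d. sequence has the law of two independent copies spliced at time \<open>n\<close>.\<close>

lemma nn_integral_walk_law_add:
  assumes [measurable]: "f \<in> borel_measurable borel"
  shows "(\<integral>\<^sup>+ x. f x \<partial>walk_law \<mu> (n + k))
    = (\<integral>\<^sup>+ g. (\<integral>\<^sup>+ h. f (g * h) \<partial>walk_law \<mu> k) \<partial>walk_law \<mu> n)"
proof -
  let ?X = "\<lambda>n \<omega>. prod_list (map \<omega> [0..<n])"
  have "(\<integral>\<^sup>+ x. f x \<partial>walk_law \<mu> (n + k)) = (\<integral>\<^sup>+ \<omega>. f (?X (n + k) \<omega>) \<partial>S)"
    unfolding walk_law_def by (rule nn_integral_distr) measurable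
  also have "\<dots> = (\<integral>\<^sup>+ \<omega>. f (?X (n + k) \<omega>) \<partial>distr (S \<Otimes>\<^sub>M S) S (\<lambda>(\<omega>, \<omega>'). comb_seq n \<omega> \<omega>'))"
    by (simp only: PiM_comb_seq)
  also have "\<dots> = (\<integral>\<^sup>+ z. f (?X (n + k) (case z of (\<omega>, \<omega>') \<Rightarrow> comb_seq n \<omega> \<omega>')) \<partial>(S \<Otimes>\<^sub>M S))"
    by (rule nn_integral_distr[OF measurable_comb_seq]) measurable
  also have "\<dots> = (\<integral>\<^sup>+ z. f (?X n (fst z) * ?X k (snd z)) \<partial>(S \<Otimes>\<^sub>M S))"
    by (rule nn_integral_cong) (auto simp: prod_list_comb_seq split: prod.splits)
  also have "\<dots> = (\<integral>\<^sup>+ \<omega>. (\<integral>\<^sup>+ \<omega>'. f (?X n \<omega> * ?X k \<omega>') \<partial>S) \<partial>S)"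
    by (subst P.nn_integral_fst[symmetric]) auto
  also have "\<dots> = (\<integral>\<^sup>+ \<omega>. (\<integral>\<^sup>+ h. f (?X n \<omega> * h) \<partial>walk_law \<mu> k) \<partial>S)"
    unfolding walk_law_def
    by (intro nn_integral_cong nn_integral_distr[symmetric]) measurable
  also have "\<dots> = (\<integral>\<^sup>+ g. (\<integral>\<^sup>+ h. f (g * h) \<partial>walk_law \<mu> k) \<partial>walk_law \<mu> n)"
    unfolding walk_law_def[of \<mu> n]
    by (rule nn_integral_distr[symmetric]) measurable
  finally show ?thesis .
qed

lemma AE_walk_law:
  assumes "AE \<omega> in S. P (prod_list (map \<omega> [0..<n]))" "{g. P g} \<in> sets borel"
  shows "AE g in walk_law \<mu> n. P g"
  unfolding walk_law_def using assms by (subst AE_distr_iff) auto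

lemma AE_component:
  assumes "AE g in \<mu>. Q g"
  shows "AE \<omega> in S. \<forall>i. Q (\<omega> i)"
  using assms by (intro AE_all_countable[THEN iffD2] allI AE_PiM_component) (auto intro: M.prob_space_axioms)

lemma displacement_prod_list_le:
  assumes "\<And>i. displacement p (\<omega> i) \<le> B"
  shows "displacement p (prod_list (map \<omega> [0..<n])) \<le> real n * B"
proof (induction n)
  case (Suc n)
  have "displacement p (prod_list (map \<omega> [0..<Suc n]))
      \<le> displacement p (prod_list (map \<omega> [0..<n])) + displacement p (\<omega> n)"
    using displacement_mult_le by simp
  also have "\<dots> \<le> real n * B + B" using Suc assms by (intro add_mono) auto
  finally show ?case by (simp add: algebra_simps)
qed simp

lemma AE_displacement_walk_law:
  assumes "AE g in \<mu>. displacement p g \<le> B"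
  shows "AE g in walk_law \<mu> n. displacement p g \<le> real n * B"
proof (rule AE_walk_law)
  show "AE \<omega> in S. displacement p (prod_list (map \<omega> [0..<n])) \<le> real n * B"
    using AE_component[OF assms] by eventually_elim (rule displacement_prod_list_le, simp)
qed measurable

end

section \<open>Four-point geometry and volume growth\<close>

text \<open>Bisection: the four-point inequality joins the two halves of a chain at the cost of a
  single \<delta>, so the loss grows with the logarithm of the length and not with the
  length.\<close>

lemma gromov_product_chain:
  fixes y :: "'a::metric_space"
  assumes hyp: "\<And>x y z p :: 'a. min (gromov_product p x z) (gromov_product p z y) - \<delta> \<le> gromov_product p x y"
    and \<delta>: "\<delta> \<ge> 0"
    and "1 \<le> n" "n \<le> 2 ^ k" "\<And>i. i < n \<Longrightarrow> c \<le> gromov_product y (z i) (z (Suc i))"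
  shows "c - real k * \<delta> \<le> gromov_product y (z 0) (z n)"
  using assms(3-)
proof (induction k arbitrary: n z)
  case 0
  then have "n = 1" by simp
  then show ?case using 0 by auto
next
  case (Suc k)
  show ?case
  proof (cases "n \<le> 2 ^ k")
    case True
    then have "c - real k * \<delta> \<le> gromov_product y (z 0) (z n)" using Suc by blast
    then show ?thesis using \<delta> by (simp add: algebra_simps)
  next
    case False
    have 1: "c - real k * \<delta> \<le> gromov_product y (z 0) (z (2 ^ k))"
      using False Suc.prems by (intro Suc.IH) auto
    have "c - real k * \<delta> \<le> gromov_product y (z (0 + 2 ^ k)) (z (n - 2 ^ k + 2 ^ k))"
      using False Suc.prems(2) Suc.prems(3) by (intro Suc.IH) auto
    then have "c - real k * \<delta> \<le> gromov_product y (z (2 ^ k)) (z n)" using False by simp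
    with 1 show ?thesis using hyp[of y "z 0" "z (2 ^ k)" "z n"] by (simp add: algebra_simps min_def split: if_splits)
  qed
qed

text \<open>Seen from \<open>y\<close>, the end points of the path have Gromov product at most \<open>\<delta>\<close>, and a chain of at
  most \<open>2 ^ k\<close> steps loses only \<open>k * \<delta>\<close>, so some single step is close to \<open>y\<close>.\<close>

lemma path_passes_near:
  fixes p :: "'a::metric_space"
  assumes hyp: "\<And>x y z p :: 'a. min (gromov_product p x z) (gromov_product p z y) - \<delta> \<le> gromov_product p x y"
    and \<delta>: "\<delta> \<ge> 0"
    and y: "dist p y = t" "dist y x = dist p x - t"
    and z: "z 0 = p" "t \<le> gromov_product p x (z n)"
      "\<And>i. i < n \<Longrightarrow> dist (z i) (z (Suc i)) \<le> B"
    and n: "1 \<le> n" "n \<le> 2 ^ k"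
  shows "\<exists>i<n. dist (z i) y \<le> (real k + 1) * \<delta> + B"
proof (rule ccontr)
  let ?R = "(real k + 1) * \<delta> + B"
  assume "\<not> ?thesis"
  then have far: "i < n \<Longrightarrow> ?R < dist (z i) y" for i by force
  \<comment> \<open>Finitely many strict inequalities are replaced by one uniform margin, taken from
    the minimal distance; it provides the strictness of the final contradiction.\<close>
  obtain c where c: "c > (real k + 1) * \<delta>" "\<And>i. i < n \<Longrightarrow> c + B \<le> dist (z i) y"
  proof
    let ?m = "Min ((\<lambda>i. dist (z i) y) ` {..<n})"
    have "?m \<in> (\<lambda>i. dist (z i) y) ` {..<n}" using n by (intro Min_in) (auto simp: lessThan_empty_iff)
    then show "?m - B > (real k + 1) * \<delta>" using far by fastforce
    show "(?m - B) + B \<le> dist (z i) y" if "i < n" for i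
      using that by simp
  qed
  \<comment> \<open>Seen from \<open>y\<close>, two points one short step apart have Gromov product
    at least their distance to \<open>y\<close> minus the step.\<close>
  have "c \<le> gromov_product y (z i) (z (Suc i))" if i: "i < n" for i
  proof -
    have "dist (z i) y \<le> dist (z i) (z (Suc i)) + dist (z (Suc i)) y" by (rule dist_triangle)
    then show ?thesis using c(2)[OF i] z(3)[OF i] unfolding gromov_product_def by simp
  qed
  from gromov_product_chain[where z = z and c = c and y = y, OF hyp \<delta> n this]
  have "c - real k * \<delta> \<le> gromov_product y p (z n)" by (simp add: z(1))
  \<comment> \<open>As \<open>y\<close> lies between \<open>p\<close> and \<open>x\<close>, their
    Gromov product at \<open>y\<close> is 0. The assumption on \<open>t\<close> says exactly that,
    of the two products through \<open>z n\<close>, the one with \<open>p\<close> is the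
    smaller.\<close>
  moreover have "gromov_product y p (z n) \<le> \<delta>"
  proof -
    have "gromov_product y p x = 0" using y by (simp add: gromov_product_def dist_commute)
    moreover have "gromov_product y p (z n) \<le> gromov_product y (z n) x"
      using z(2) y by (simp add: gromov_product_def dist_commute)
    ultimately show ?thesis using hyp[of y p "z n" x] by (simp add: min_def split: if_splits)
  qed
  ultimately show False using c(1) by (simp add: algebra_simps)
qed

lemma geodesic_point:
  fixes x y :: "'a::metric_space"
  assumes "geodesic_metric TYPE('a)" "0 \<le> t" "t \<le> dist x y"
  obtains z where "dist x z = t" "dist z y = dist x y - t"
proof -
  obtain c :: "real \<Rightarrow> 'a" where c: "c 0 = x" "c (dist x y) = y"
    "\<forall>s\<in>{0..dist x y}. \<forall>t\<in>{0..dist x y}. dist (c s) (c t) = \<bar>s - t\<bar>"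
    using assms(1) unfolding geodesic_metric_def by metis
  have "dist (c 0) (c t) = \<bar>0 - t\<bar>" "dist (c t) (c (dist x y)) = \<bar>t - dist x y\<bar>"
    using assms by (intro c(3)[rule_format]; simp)+
  then show thesis using that[of "c t"] assms by (simp add: c)
qed

section \<open>Exponential growth of the orbit and of Haar measure\<close>

lemma cocompact_orbit_dense:
  fixes p :: "'a::metric_space"
  assumes "isom_cocompact TYPE('a)"
  obtains D where "D \<ge> 0" "\<And>y. \<exists>g. dist (app_isom g p) y \<le> D"
proof -
  obtain K :: "'a set" where K: "compact K" "(\<Union>g. app_isom g ` K) = UNIV"
    using assms unfolding isom_cocompact_def by auto
  obtain D where D: "\<And>x. x \<in> K \<Longrightarrow> dist p x \<le> D"
    using compact_imp_bounded[OF K(1)] bounded_any_center[of K p] by auto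
  show thesis
  proof
    show "max 0 D \<ge> 0" by simp
    fix y
    have "y \<in> (\<Union>g. app_isom g ` K)" by (simp add: K(2))
    then obtain g x where "x \<in> K" "y = app_isom g x" by blast
    then show "\<exists>g. dist (app_isom g p) y \<le> max 0 D" using D by (auto intro!: exI[of _ g] simp: le_max_iff_disj)
  qed
qed

text \<open>A point of the ball of radius n + 1 lies one unit beyond a point already covered by some
  \<open>a\<close>; pulled back by \<open>a\<close> it falls into a fixed ball around
  \<open>p\<close>, which a fixed finite set \<open>F\<close> covers. Each unit of radius thus
  multiplies the count by at most \<open>card F\<close>.\<close>

lemma orbit_ball_cover:
  fixes p :: "'a::metric_space"
  assumes pm: "proper_metric TYPE('a)" and geo: "geodesic_metric TYPE('a)"
    and D: "D \<ge> 0" "\<And>y. \<exists>g. dist (app_isom g p) y \<le> D"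
  shows "\<exists>N :: nat. \<forall>n. \<exists>A. finite A \<and> card A \<le> N ^ n \<and>
    (\<forall>y. dist p y \<le> real n \<longrightarrow> (\<exists>a\<in>A. dist (app_isom a p) y \<le> D + 1))"
proof -
  \<comment> \<open>Radius \<open>D + 2\<close>: the covering error \<open>D + 1\<close> plus one
    unit of radius.\<close>
  obtain X where X: "finite X" "cball p (D + 2) \<subseteq> (\<Union>x\<in>X. ball x 1)"
    using compact_eq_totally_bounded[THEN iffD1, THEN conjunct2, rule_format, of "cball p (D + 2)" 1] pm
    unfolding proper_metric_def by auto
  define f where "f y = (SOME g. dist (app_isom g p) y \<le> D)" for y
  have f: "dist (app_isom (f y) p) y \<le> D" for y
    unfolding f_def using D(2) by (rule someI_ex)
  define F where "F = f ` X"
  have F: "finite F" using X by (simp add: F_def)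
  have Fcov: "\<exists>a\<in>F. dist (app_isom a p) y \<le> D + 1" if "dist p y \<le> D + 2" for y
  proof -
    have "y \<in> cball p (D + 2)" using that by simp
    then obtain x where x: "x \<in> X" "dist x y < 1" using X by auto
    have "dist (app_isom (f x) p) y \<le> D + 1"
      using dist_triangle[of "app_isom (f x) p" y x] f[of x] x by linarith
    then show ?thesis using x by (auto simp: F_def)
  qed
  have "\<exists>A. finite A \<and> card A \<le> card F ^ n \<and>
    (\<forall>y. dist p y \<le> real n \<longrightarrow> (\<exists>a\<in>A. dist (app_isom a p) y \<le> D + 1))" for n
  proof (induction n)
    case 0
    then show ?case using D(1) by (intro exI[of _ "{1}"]) simp
  next
    case (Suc n)
    then obtain A where A: "finite A" "card A \<le> card F ^ n"
      "\<And>y. dist p y \<le> real n \<Longrightarrow> \<exists>a\<in>A. dist (app_isom a p) y \<le> D + 1" by blast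
    let ?A = "(\<lambda>(a, b). a * b) ` (A \<times> F)"
    have "card ?A \<le> card (A \<times> F)" using A F by (intro card_image_le) simp
    also have "\<dots> \<le> card F ^ Suc n" using A(2) by (simp add: card_cartesian_product mult.commute)
    finally have card: "card ?A \<le> card F ^ Suc n" .
    have "\<exists>a\<in>?A. dist (app_isom a p) y \<le> D + 1" if y: "dist p y \<le> real (Suc n)" for y
    proof -
      obtain y' where y': "dist p y' = min (real n) (dist p y)" "dist y' y = dist p y - min (real n) (dist p y)"
        by (rule geodesic_point[OF geo, of "min (real n) (dist p y)" p y]) auto
      then obtain a where a: "a \<in> A" "dist (app_isom a p) y' \<le> D + 1" using A(3)[of y'] by auto
      have "dist (app_isom a p) y \<le> D + 2"
        using dist_triangle[of "app_isom a p" y y'] a y y' by (simp add: min_def split: if_splits)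
      then have "dist p (app_isom (inverse a) y) \<le> D + 2"
        using dist_app_isom[of a p "app_isom (inverse a) y"] by simp
      then obtain b where b: "b \<in> F" "dist (app_isom b p) (app_isom (inverse a) y) \<le> D + 1"
        using Fcov by blast
      then have "dist (app_isom (a * b) p) y \<le> D + 1"
        using dist_app_isom[of a "app_isom b p" "app_isom (inverse a) y"] by simp
      then show ?thesis using a b by (intro bexI[of _ "a * b"]) auto
    qed
    then show ?case using A F card by (intro exI[of _ ?A]) auto
  qed
  then show ?thesis by blast
qed

locale haar_isom =
  fixes \<nu> :: "'a::metric_space isom measure" and p :: 'a
  assumes pm: "proper_metric TYPE('a)" and haar: "left_haar_measure \<nu>"
begin

lemma sets_nu [simp, measurable_cong]: "sets \<nu> = sets borel"
  using haar by (simp add: left_haar_measure_def)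

lemma space_nu [simp]: "space \<nu> = UNIV"
  using sets_eq_imp_space_eq[OF sets_nu] by simp

lemma emeasure_displacement_finite: "emeasure \<nu> {g. displacement p g \<le> R} < \<infinity>"
  using haar compact_displacement_le[OF pm] by (simp add: left_haar_measure_def)

lemma UN_displacement: "(\<Union>n. {g. displacement p g \<le> real n}) = UNIV"
  using real_arch_simple by auto

sublocale sigma_finite_measure \<nu>
proof
  show "\<exists>A. countable A \<and> A \<subseteq> sets \<nu> \<and> \<Union> A = space \<nu> \<and> (\<forall>a\<in>A. emeasure \<nu> a \<noteq> \<infinity>)"
    using emeasure_displacement_finite UN_displacement
    by (intro exI[of _ "range (\<lambda>n. {g. displacement p g \<le> real n})"]) (auto simp: less_top)
qed

lemma emeasure_displacement_pos:
  obtains E where "E \<ge> 0" "emeasure \<nu> {g. displacement p g \<le> E} > 0"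
proof -
  have "\<not> (\<forall>n. emeasure \<nu> {g. displacement p g \<le> real n} = 0)"
  proof
    assume "\<forall>n. emeasure \<nu> {g. displacement p g \<le> real n} = 0"
    then have "emeasure \<nu> (\<Union>n. {g. displacement p g \<le> real n}) = 0"
      by (intro emeasure_UN_eq_0) auto
    then show False using haar by (simp add: UN_displacement left_haar_measure_def)
  qed
  then show thesis using that[of "real n" for n] by (auto simp: zero_less_iff_neq_zero)
qed

lemma distr_left_mult: "distr \<nu> borel ((*) g) = \<nu>"
proof (rule measure_eqI)
  have m: "(*) g \<in> \<nu> \<rightarrow>\<^sub>M borel"
    by (rule measurable_isom_mult[OF pm]) auto
  fix A assume A: "A \<in> sets (distr \<nu> borel ((*) g))"
  have "(*) g -` A = (*) (inverse g) ` A"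
    by (auto simp: image_iff intro!: bexI[of _ "g * x" for x])
  then have "emeasure (distr \<nu> borel ((*) g)) A = emeasure \<nu> ((*) (inverse g) ` A)"
    using A by (subst emeasure_distr[OF m]) auto
  also have "\<dots> = emeasure \<nu> A" using haar A by (simp add: left_haar_measure_def)
  finally show "emeasure (distr \<nu> borel ((*) g)) A = emeasure \<nu> A" .
qed simp

lemma nn_integral_left_mult:
  assumes [measurable]: "f \<in> borel_measurable borel"
  shows "(\<integral>\<^sup>+ h. f (g * h) \<partial>\<nu>) = (\<integral>\<^sup>+ h. f h \<partial>\<nu>)"
proof -
  have m: "(*) g \<in> \<nu> \<rightarrow>\<^sub>M borel"
    by (rule measurable_isom_mult[OF pm]) auto
  have "(\<integral>\<^sup>+ h. f h \<partial>\<nu>) = (\<integral>\<^sup>+ h. f h \<partial>distr \<nu> borel ((*) g))" by (simp add: distr_left_mult)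
  also have "\<dots> = (\<integral>\<^sup>+ h. f (g * h) \<partial>\<nu>)" by (rule nn_integral_distr[OF m]) simp
  finally show ?thesis by simp
qed

lemma emeasure_translate:
  "emeasure \<nu> {h. displacement p (inverse g * h) \<le> R} = emeasure \<nu> {h. displacement p h \<le> R}"
proof -
  have "{h. displacement p (inverse g * h) \<le> R} = (*) g ` {h. displacement p h \<le> R}"
    by (auto simp: image_iff intro!: exI[of _ "inverse g * x" for x])
  then show ?thesis using haar by (simp add: left_haar_measure_def)
qed

text \<open>A displacement ball is covered by left translates of one fixed ball, all of equal Haar
  measure, so counting translates bounds the volume.\<close>

lemma volume_growth:
  assumes geo: "geodesic_metric TYPE('a)" and D: "D \<ge> 0" "\<And>y. \<exists>g. dist (app_isom g p) y \<le> D"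
  obtains N V where "N \<ge> 1" "V \<ge> 0"
    "\<And>R. R \<ge> 0 \<Longrightarrow> emeasure \<nu> {g. displacement p g \<le> R} \<le> ennreal (V * N powr R)"
proof -
  obtain N :: nat where N: "\<And>n. \<exists>A. finite A \<and> card A \<le> N ^ n \<and>
    (\<forall>y. dist p y \<le> real n \<longrightarrow> (\<exists>a\<in>A. dist (app_isom a p) y \<le> D + 1))"
    using orbit_ball_cover[OF pm geo D] by (elim exE) blast
  let ?Q = "\<lambda>R. {g. displacement p g \<le> R}"
  \<comment> \<open>Taking the maximum with 1 makes powers increase with the exponent, needed when
    \<open>R\<close> is rounded up to an integer.\<close>
  define N' where "N' = real (max 1 N)"
  define v where "v = enn2real (emeasure \<nu> (?Q (D + 1)))"
  have v: "emeasure \<nu> (?Q (D + 1)) = ennreal v" "v \<ge> 0"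
    using emeasure_displacement_finite[of "D + 1"] by (auto simp: v_def)
  show thesis
  proof
    show "N' \<ge> 1" "v * N' \<ge> 0" using v by (auto simp: N'_def)
    fix R :: real assume R: "R \<ge> 0"
    define n where "n = nat \<lceil>R\<rceil>"
    have n: "R \<le> real n" "real n \<le> R + 1" using R by (auto simp: n_def)
    obtain A where A: "finite A" "card A \<le> N ^ n"
      "\<And>y. dist p y \<le> real n \<Longrightarrow> \<exists>a\<in>A. dist (app_isom a p) y \<le> D + 1" using N by blast
    have "?Q R \<subseteq> (\<Union>a\<in>A. {h. displacement p (inverse a * h) \<le> D + 1})"
    proof
      fix g assume "g \<in> ?Q R"
      then have "dist p (app_isom g p) \<le> real n" using n by (simp add: displacement_def dist_commute)
      then obtain a where "a \<in> A" "dist (app_isom a p) (app_isom g p) \<le> D + 1" using A(3) by blast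
      then show "g \<in> (\<Union>a\<in>A. {h. displacement p (inverse a * h) \<le> D + 1})"
        by (auto simp: displacement_def dist_inverse_isom dist_commute[of "app_isom g p"])
    qed
    moreover have m: "{h. displacement p (inverse a * h) \<le> D + 1} \<in> sets \<nu>" for a
    proof -
      have "(\<lambda>h. displacement p (inverse a * h)) \<in> borel_measurable borel"
        by (intro measurable_compose[OF measurable_isom_mult[OF pm] borel_measurable_displacement]) auto
      then show ?thesis by simp
    qed
    ultimately have "emeasure \<nu> (?Q R) \<le> emeasure \<nu> (\<Union>a\<in>A. {h. displacement p (inverse a * h) \<le> D + 1})"
      using A(1) by (intro emeasure_mono sets.finite_UN) auto
    also have "\<dots> \<le> (\<Sum>a\<in>A. emeasure \<nu> {h. displacement p (inverse a * h) \<le> D + 1})"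
      using A(1) m by (intro emeasure_subadditive_finite) auto
    also have "\<dots> = ennreal (real (card A) * v)"
      by (simp add: emeasure_translate v ennreal_mult ennreal_of_nat_eq_real_of_nat)
    also have "\<dots> \<le> ennreal (v * N' * N' powr R)"
    proof (rule ennreal_leI)
      have "real (card A) \<le> real (N ^ n)" using A(2) by (simp only: of_nat_le_iff)
      also have "\<dots> \<le> N' ^ n" by (auto simp: N'_def intro: power_mono)
      also have "\<dots> = N' powr real n" by (simp add: N'_def powr_realpow)
      also have "\<dots> \<le> N' powr (R + 1)" using n by (intro powr_mono) (auto simp: N'_def)
      also have "\<dots> = N' * N' powr R" by (simp add: N'_def powr_add)
      finally have "real (card A) * v \<le> (N' * N' powr R) * v" using v by (intro mult_right_mono)
      then show "real (card A) * v \<le> v * N' * N' powr R" by (simp add: mult_ac)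
    qed
    finally show "emeasure \<nu> (?Q R) \<le> ennreal (v * N' * N' powr R)" .
  qed
qed

end

section \<open>Spectral gap and hitting probabilities\<close>

declare borel_measurable_app_isom [measurable (raw)]

lemma square_integrable_nn_integral:
  assumes f: "f \<in> borel_measurable M" and le: "(\<integral>\<^sup>+ x. ennreal ((cmod (f x))\<^sup>2) \<partial>M) \<le> ennreal c"
    and c: "c \<ge> 0"
  shows "square_integrable M f" "(L2_norm M f)\<^sup>2 \<le> c"
    "ennreal ((L2_norm M f)\<^sup>2) = (\<integral>\<^sup>+ x. ennreal ((cmod (f x))\<^sup>2) \<partial>M)"
proof -
  have i: "integrable M (\<lambda>x. (cmod (f x))\<^sup>2)"
    using f le by (intro integrableI_bounded) (auto simp: le_less_trans)
  then show "square_integrable M f" using f by (simp add: square_integrable_def)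
  show e: "ennreal ((L2_norm M f)\<^sup>2) = (\<integral>\<^sup>+ x. ennreal ((cmod (f x))\<^sup>2) \<partial>M)"
    using nn_integral_eq_integral[OF i] by (simp add: L2_norm_def)
  show "(L2_norm M f)\<^sup>2 \<le> c" using le c unfolding e[symmetric] by simp
qed

lemma square_integrable_nn_integral_eq:
  assumes "square_integrable M f"
  shows "(\<integral>\<^sup>+ x. ennreal ((cmod (f x))\<^sup>2) \<partial>M) = ennreal ((L2_norm M f)\<^sup>2)"
  using assms nn_integral_eq_integral[of M "\<lambda>x. (cmod (f x))\<^sup>2"]
  by (simp add: L2_norm_def square_integrable_def)

lemma L2_norm_nonneg: "L2_norm M f \<ge> 0"
  by (simp add: L2_norm_def)

lemma (in prob_space) norm_integral_square_le:
  fixes f :: "'a \<Rightarrow> complex"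
  assumes [measurable]: "f \<in> borel_measurable M"
  shows "ennreal ((cmod (\<integral>x. f x \<partial>M))\<^sup>2) \<le> (\<integral>\<^sup>+ x. ennreal ((cmod (f x))\<^sup>2) \<partial>M)"
proof (cases "integrable M f")
  case True
  have "ennreal ((cmod (\<integral>x. f x \<partial>M))\<^sup>2) = (ennreal (cmod (\<integral>x. f x \<partial>M)))\<^sup>2"
    by (simp add: ennreal_power)
  also have "\<dots> \<le> (\<integral>\<^sup>+ x. ennreal (cmod (f x)) \<partial>M)\<^sup>2"
    using True by (intro power_mono integral_norm_bound_ennreal) auto
  also have "\<dots> = (\<integral>\<^sup>+ x. ennreal (cmod (f x)) * 1 \<partial>M)\<^sup>2" by simp
  also have "\<dots> \<le> (\<integral>\<^sup>+ x. (ennreal (cmod (f x)))\<^sup>2 \<partial>M) * (\<integral>\<^sup>+ x. 1\<^sup>2 \<partial>M)"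
    by (rule Cauchy_Schwarz_nn_integral) auto
  also have "\<dots> = (\<integral>\<^sup>+ x. ennreal ((cmod (f x))\<^sup>2) \<partial>M)"
    by (simp add: emeasure_space_1 ennreal_power)
  finally show ?thesis .
\<comment> \<open>Without integrability the Bochner integral takes its default value 0.\<close>
qed (simp add: not_integrable_integral_eq)

context haar_isom
begin

lemma measurable_translate [measurable (raw)]:
  assumes "u \<in> M \<rightarrow>\<^sub>M borel" "v \<in> M \<rightarrow>\<^sub>M (borel :: 'a isom measure)"
  shows "(\<lambda>w. inverse (u w) * v w) \<in> M \<rightarrow>\<^sub>M borel"
  by (intro measurable_isom_mult[OF pm] measurable_isom_inverse[OF pm] assms)

text \<open>Minkowski's inequality, without which the supremum in \<open>left_regular_norm\<close> could be a junk value.\<close>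

lemma nn_integral_left_regular_le:
  assumes bp: "borel_prob m" and f [measurable]: "f \<in> borel_measurable borel"
  shows "left_regular_measure m f \<in> borel_measurable \<nu>"
    "(\<integral>\<^sup>+ h. ennreal ((cmod (left_regular_measure m f h))\<^sup>2) \<partial>\<nu>)
      \<le> (\<integral>\<^sup>+ h. ennreal ((cmod (f h))\<^sup>2) \<partial>\<nu>)"
proof -
  interpret m: prob_space m using borel_probD[OF bp] by auto
  note [measurable_cong] = borel_probD(2)[OF bp]
  interpret pair_sigma_finite m \<nu> ..
  show "left_regular_measure m f \<in> borel_measurable \<nu>"
    unfolding left_regular_measure_def left_regular_def
    by (rule m.borel_measurable_lebesgue_integral) measurable
  have "(\<integral>\<^sup>+ h. ennreal ((cmod (left_regular_measure m f h))\<^sup>2) \<partial>\<nu>)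
      \<le> (\<integral>\<^sup>+ h. (\<integral>\<^sup>+ x. ennreal ((cmod (f (inverse x * h)))\<^sup>2) \<partial>m) \<partial>\<nu>)"
    unfolding left_regular_measure_def left_regular_def
    by (intro nn_integral_mono m.norm_integral_square_le) measurable
  also have "\<dots> = (\<integral>\<^sup>+ x. (\<integral>\<^sup>+ h. ennreal ((cmod (f (inverse x * h)))\<^sup>2) \<partial>\<nu>) \<partial>m)"
    by (rule Fubini') measurable
  also have "\<dots> = (\<integral>\<^sup>+ x. (\<integral>\<^sup>+ h. ennreal ((cmod (f h))\<^sup>2) \<partial>\<nu>) \<partial>m)"
    by (intro nn_integral_cong nn_integral_left_mult[where f = "\<lambda>h. ennreal ((cmod (f h))\<^sup>2)"]) measurable
  also have "\<dots> = (\<integral>\<^sup>+ h. ennreal ((cmod (f h))\<^sup>2) \<partial>\<nu>)"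
    by (simp add: m.emeasure_space_1)
  finally show "(\<integral>\<^sup>+ h. ennreal ((cmod (left_regular_measure m f h))\<^sup>2) \<partial>\<nu>)
      \<le> (\<integral>\<^sup>+ h. ennreal ((cmod (f h))\<^sup>2) \<partial>\<nu>)" .
qed

lemma L2_norm_left_regular_le:
  assumes bp: "borel_prob m" and f: "square_integrable \<nu> f" "L2_norm \<nu> f \<le> 1"
  shows "L2_norm \<nu> (left_regular_measure m f) \<le> left_regular_norm \<nu> m"
  unfolding left_regular_norm_def
proof (rule cSUP_upper)
  have "L2_norm \<nu> (left_regular_measure m f) \<le> 1"
    if f: "square_integrable \<nu> f" "L2_norm \<nu> f \<le> 1" for f
  proof -
    have fm: "f \<in> borel_measurable borel"
      using f(1) measurable_cong_sets[OF sets_nu refl, of borel] by (auto simp: square_integrable_def)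
    have "(\<integral>\<^sup>+ h. ennreal ((cmod (left_regular_measure m f h))\<^sup>2) \<partial>\<nu>) \<le> ennreal ((L2_norm \<nu> f)\<^sup>2)"
      using nn_integral_left_regular_le(2)[OF bp fm] square_integrable_nn_integral_eq[OF f(1)] by simp
    also have "\<dots> \<le> ennreal 1"
      using f(2) L2_norm_nonneg[of \<nu> f] by (intro ennreal_leI) (simp add: power_le_one)
    finally have "(L2_norm \<nu> (left_regular_measure m f))\<^sup>2 \<le> 1"
      by (rule square_integrable_nn_integral(2)[OF nn_integral_left_regular_le(1)[OF bp fm]]) simp
    then show ?thesis using L2_norm_nonneg by (simp add: power_le_one_iff abs_square_le_1)
  qed
  then show "bdd_above ((\<lambda>f. L2_norm \<nu> (left_regular_measure m f)) `
      {f. square_integrable \<nu> f \<and> L2_norm \<nu> f \<le> 1})"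
    by (intro bdd_aboveI[of _ 1]) auto
qed (use f in simp)

text \<open>The operator norm is a supremum over complex functions in the unit ball; scaling by the
  inverse of the norm gives the inequality for every real function of finite norm.\<close>

lemma spectral_gap_step:
  fixes f :: "'a isom \<Rightarrow> real"
  assumes bp: "borel_prob m" and gap: "left_regular_norm \<nu> m \<le> \<rho>" and \<rho>: "\<rho> \<ge> 0"
    and f [measurable]: "f \<in> borel_measurable borel"
    and fin: "(\<integral>\<^sup>+ h. ennreal ((f h)\<^sup>2) \<partial>\<nu>) < \<infinity>"
  shows "(\<integral>\<^sup>+ h. ennreal ((\<integral>x. f (inverse x * h) \<partial>m)\<^sup>2) \<partial>\<nu>)
    \<le> ennreal (\<rho>\<^sup>2) * (\<integral>\<^sup>+ h. ennreal ((f h)\<^sup>2) \<partial>\<nu>)"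
proof -
  interpret m: prob_space m using borel_probD[OF bp] by auto
  note [measurable_cong] = borel_probD(2)[OF bp]
  define F where "F s h = complex_of_real (s * f h)" for s h
  have F [measurable]: "F s \<in> borel_measurable borel" for s unfolding F_def by measurable
  let ?T = "\<lambda>h. \<integral>x. f (inverse x * h) \<partial>m"
  have LF: "left_regular_measure m (F s) h = complex_of_real (s * ?T h)" for s h
    unfolding left_regular_measure_def left_regular_def F_def integral_complex_of_real by simp
  have [measurable]: "?T \<in> borel_measurable borel"
    by (rule m.borel_measurable_lebesgue_integral) measurable
  define c where "c = sqrt (enn2real (\<integral>\<^sup>+ h. ennreal ((f h)\<^sup>2) \<partial>\<nu>))"
  have c: "(\<integral>\<^sup>+ h. ennreal ((f h)\<^sup>2) \<partial>\<nu>) = ennreal (c\<^sup>2)" "c \<ge> 0"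
    using fin by (auto simp: c_def)
  have nnF: "(\<integral>\<^sup>+ h. ennreal ((cmod (F s h))\<^sup>2) \<partial>\<nu>) = ennreal (s\<^sup>2 * c\<^sup>2)" for s
  proof -
    have "(\<integral>\<^sup>+ h. ennreal ((cmod (F s h))\<^sup>2) \<partial>\<nu>) = (\<integral>\<^sup>+ h. ennreal (s\<^sup>2) * ennreal ((f h)\<^sup>2) \<partial>\<nu>)"
      by (intro nn_integral_cong) (simp add: F_def norm_mult power_mult_distrib ennreal_mult)
    also have "\<dots> = ennreal (s\<^sup>2) * ennreal (c\<^sup>2)" by (subst nn_integral_cmult) (auto simp: c)
    finally show ?thesis by (simp add: ennreal_mult)
  qed
  have nnT: "(\<integral>\<^sup>+ h. ennreal ((cmod (left_regular_measure m (F s) h))\<^sup>2) \<partial>\<nu>)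
      = ennreal (s\<^sup>2) * (\<integral>\<^sup>+ h. ennreal ((?T h)\<^sup>2) \<partial>\<nu>)" for s
  proof -
    have "(\<integral>\<^sup>+ h. ennreal ((cmod (left_regular_measure m (F s) h))\<^sup>2) \<partial>\<nu>)
        = (\<integral>\<^sup>+ h. ennreal (s\<^sup>2) * ennreal ((?T h)\<^sup>2) \<partial>\<nu>)"
      by (intro nn_integral_cong) (simp add: LF norm_mult power_mult_distrib ennreal_mult)
    also have "\<dots> = ennreal (s\<^sup>2) * (\<integral>\<^sup>+ h. ennreal ((?T h)\<^sup>2) \<partial>\<nu>)"
      by (rule nn_integral_cmult) measurable
    finally show ?thesis .
  qed
  show ?thesis
  \<comment> \<open>A function of norm 0 cannot be normalised; Minkowski's inequality settles this
    case.\<close>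
  proof (cases "c = 0")
    case True
    then show ?thesis
      using nn_integral_left_regular_le(2)[OF bp F, of 1] unfolding nnT nnF by simp
  next
    case False
    define s where "s = 1 / c"
    have sc: "s\<^sup>2 * c\<^sup>2 = 1" using False by (simp add: s_def power_divide)
    have sq: "square_integrable \<nu> (F s)" "(L2_norm \<nu> (F s))\<^sup>2 \<le> 1"
      by (rule square_integrable_nn_integral[of "F s" \<nu> 1]; simp add: nnF sc)+
    have "L2_norm \<nu> (F s) \<le> 1" using sq(2) by (simp add: power_le_one_iff abs_square_le_1)
    then have "L2_norm \<nu> (left_regular_measure m (F s)) \<le> \<rho>"
      using L2_norm_left_regular_le[OF bp sq(1)] gap by simp
    then have le: "(L2_norm \<nu> (left_regular_measure m (F s)))\<^sup>2 \<le> \<rho>\<^sup>2"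
      using L2_norm_nonneg by (intro power_mono) auto
    have "(\<integral>\<^sup>+ h. ennreal ((cmod (left_regular_measure m (F s) h))\<^sup>2) \<partial>\<nu>) \<le> ennreal 1"
      using nn_integral_left_regular_le(2)[OF bp F, of s] unfolding nnF sc .
    from square_integrable_nn_integral(3)[OF nn_integral_left_regular_le(1)[OF bp F] this zero_le_one]
    have "ennreal (s\<^sup>2) * (\<integral>\<^sup>+ h. ennreal ((?T h)\<^sup>2) \<partial>\<nu>)
        = ennreal ((L2_norm \<nu> (left_regular_measure m (F s)))\<^sup>2)"
      unfolding nnT[symmetric] by (rule sym)
    also have "\<dots> \<le> ennreal (\<rho>\<^sup>2)" by (rule ennreal_leI[OF le])
    finally have "ennreal (s\<^sup>2) * (\<integral>\<^sup>+ h. ennreal ((?T h)\<^sup>2) \<partial>\<nu>) \<le> ennreal (\<rho>\<^sup>2)" .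
    then have "ennreal (c\<^sup>2) * (ennreal (s\<^sup>2) * (\<integral>\<^sup>+ h. ennreal ((?T h)\<^sup>2) \<partial>\<nu>))
        \<le> ennreal (c\<^sup>2) * ennreal (\<rho>\<^sup>2)" by (intro mult_left_mono) auto
    also have "ennreal (c\<^sup>2) * (ennreal (s\<^sup>2) * (\<integral>\<^sup>+ h. ennreal ((?T h)\<^sup>2) \<partial>\<nu>))
        = ennreal (s\<^sup>2 * c\<^sup>2) * (\<integral>\<^sup>+ h. ennreal ((?T h)\<^sup>2) \<partial>\<nu>)"
      by (simp add: ennreal_mult mult_ac)
    finally show ?thesis unfolding sc c by (simp add: mult.commute)
  qed
qed

text \<open>The first increment is peeled off: inverting a product reverses it, so averaging over
  \<open>Suc n\<close> increments is one application of the operator to the average over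
  \<open>n\<close>. Values in the unit interval persist and keep every average integrable.\<close>

lemma spectral_gap_iterate:
  fixes f :: "'a isom \<Rightarrow> real"
  assumes bp: "borel_prob m" and gap: "left_regular_norm \<nu> m \<le> \<rho>" and \<rho>: "\<rho> \<ge> 0"
    and f [measurable]: "f \<in> borel_measurable borel" and f01: "\<And>h. 0 \<le> f h" "\<And>h. f h \<le> 1"
    and fin: "(\<integral>\<^sup>+ h. ennreal ((f h)\<^sup>2) \<partial>\<nu>) < \<infinity>"
  shows "(\<integral>\<^sup>+ h. (\<integral>\<^sup>+ x. ennreal (f (inverse x * h)) \<partial>walk_law m n)\<^sup>2 \<partial>\<nu>)
    \<le> ennreal (\<rho>\<^sup>2 ^ n) * (\<integral>\<^sup>+ h. ennreal ((f h)\<^sup>2) \<partial>\<nu>)"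
proof (induction n)
  case 0
  interpret W: isom_walk m by unfold_locales (rule pm bp)+
  show ?case by (simp add: W.walk_law_0 nn_integral_return ennreal_power f01)
next
  case (Suc n)
  interpret W: isom_walk m by unfold_locales (rule pm bp)+
  define u where "u h = (\<integral>x. f (inverse x * h) \<partial>walk_law m n)" for h
  have int: "integrable (walk_law m n) (\<lambda>x. f (inverse x * h))" for h
    using f01 by (intro W.L.integrable_const_bound[where B = 1]) auto
  have u: "(\<integral>\<^sup>+ x. ennreal (f (inverse x * h)) \<partial>walk_law m n) = ennreal (u h)" for h
    unfolding u_def using nn_integral_eq_integral[OF int] f01 by simp
  have u01: "0 \<le> u h" "u h \<le> 1" for h
  proof -
    show "0 \<le> u h" unfolding u_def using f01 by simp
    show "u h \<le> 1" unfolding u_def using W.L.integral_le_const[OF int] f01 by simp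
  qed
  have [measurable]: "u \<in> borel_measurable borel"
    unfolding u_def by (rule W.L.borel_measurable_lebesgue_integral) measurable
  have intu: "integrable m (\<lambda>x. u (inverse x * h))" for h
    using u01 by (intro W.M.integrable_const_bound[where B = 1]) auto
  have IH: "(\<integral>\<^sup>+ h. ennreal ((u h)\<^sup>2) \<partial>\<nu>) \<le> ennreal (\<rho>\<^sup>2 ^ n) * (\<integral>\<^sup>+ h. ennreal ((f h)\<^sup>2) \<partial>\<nu>)"
    using Suc by (simp add: u ennreal_power u01)
  also have "\<dots> < \<infinity>" using fin by (simp add: ennreal_mult_less_top)
  finally have finu: "(\<integral>\<^sup>+ h. ennreal ((u h)\<^sup>2) \<partial>\<nu>) < \<infinity>" .
  have "(\<integral>\<^sup>+ x. ennreal (f (inverse x * h)) \<partial>walk_law m (Suc n))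
      = ennreal (\<integral>x. u (inverse x * h) \<partial>m)" for h
  proof -
    have "(\<integral>\<^sup>+ x. ennreal (f (inverse x * h)) \<partial>walk_law m (Suc 0 + n))
      = (\<integral>\<^sup>+ g. (\<integral>\<^sup>+ x. ennreal (f (inverse (g * x) * h)) \<partial>walk_law m n) \<partial>m)"
      by (subst W.nn_integral_walk_law_add) (simp_all add: W.walk_law_1)
    also have "\<dots> = (\<integral>\<^sup>+ g. ennreal (u (inverse g * h)) \<partial>m)"
      by (simp add: isom_inverse_distrib mult.assoc u)
    also have "\<dots> = ennreal (\<integral>x. u (inverse x * h) \<partial>m)"
      using nn_integral_eq_integral[OF intu] u01 by simp
    finally show ?thesis by simp
  qed
  then have "(\<integral>\<^sup>+ h. (\<integral>\<^sup>+ x. ennreal (f (inverse x * h)) \<partial>walk_law m (Suc n))\<^sup>2 \<partial>\<nu>)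
      = (\<integral>\<^sup>+ h. ennreal ((\<integral>x. u (inverse x * h) \<partial>m)\<^sup>2) \<partial>\<nu>)"
    using u01 by (simp add: ennreal_power)
  also have "\<dots> \<le> ennreal (\<rho>\<^sup>2) * (\<integral>\<^sup>+ h. ennreal ((u h)\<^sup>2) \<partial>\<nu>)"
    by (rule spectral_gap_step[OF bp gap \<rho> _ finu]) measurable
  also have "\<dots> \<le> ennreal (\<rho>\<^sup>2) * (ennreal (\<rho>\<^sup>2 ^ n) * (\<integral>\<^sup>+ h. ennreal ((f h)\<^sup>2) \<partial>\<nu>))"
    by (intro mult_left_mono IH) simp
  also have "\<dots> = ennreal (\<rho>\<^sup>2 ^ Suc n) * (\<integral>\<^sup>+ h. ennreal ((f h)\<^sup>2) \<partial>\<nu>)"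
    by (simp add: ennreal_mult mult.assoc)
  finally show ?case .
qed

text \<open>A matrix coefficient estimate. The mass sought, times the volume v of a displacement
  ball, is at most the pairing of the averaged indicator of that ball with the indicator of the
  enlarged target. Cauchy-Schwarz and the gap bound the square by \<open>\<rho>\<^sup>2 ^ n\<close>
  times the target volume times v, and one factor v cancels. The thickening by \<open>E\<close>
  turns a statement on a law into one on square-integrable functions.\<close>

lemma hitting_le_volume:
  assumes bp: "borel_prob m" and gap: "left_regular_norm \<nu> m \<le> \<rho>" and \<rho>: "\<rho> \<ge> 0"
  shows "(emeasure (walk_law m n) {x. dist (app_isom x p) y \<le> R})\<^sup>2 * emeasure \<nu> {h. displacement p h \<le> E}
    \<le> ennreal (\<rho>\<^sup>2 ^ n) * emeasure \<nu> {h. dist (app_isom h p) y \<le> R + E}"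
proof -
  interpret W: isom_walk m by unfold_locales (rule pm bp)+
  interpret pair_sigma_finite "walk_law m n" \<nu> ..
  let ?A = "{x. dist (app_isom x p) y \<le> R}" and ?A' = "{h. dist (app_isom h p) y \<le> R + E}"
  let ?Q = "{h. displacement p h \<le> E}"
  have [measurable]: "?A \<in> sets borel" "?A' \<in> sets borel" "?Q \<in> sets borel" by measurable
  let ?v = "emeasure \<nu> ?Q"
  define f where "f = (indicator ?Q :: 'a isom \<Rightarrow> real)"
  have f [measurable]: "f \<in> borel_measurable borel" unfolding f_def by measurable
  have nnf: "(\<integral>\<^sup>+ h. ennreal ((f h)\<^sup>2) \<partial>\<nu>) = ?v"
  proof -
    have "ennreal ((f h)\<^sup>2) = indicator ?Q h" for h by (simp add: f_def indicator_def)
    then show ?thesis by simp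
  qed
  have vf: "?v < \<infinity>" by (rule emeasure_displacement_finite)
  let ?u = "\<lambda>h. \<integral>\<^sup>+ x. ennreal (f (inverse x * h)) \<partial>walk_law m n"
  have "emeasure (walk_law m n) ?A * ?v = (\<integral>\<^sup>+ x. indicator ?A x * ?v \<partial>walk_law m n)"
    by (simp add: nn_integral_multc)
  also have "\<dots> \<le> (\<integral>\<^sup>+ x. (\<integral>\<^sup>+ h. indicator ?A' h * ennreal (f (inverse x * h)) \<partial>\<nu>) \<partial>walk_law m n)"
  proof (rule nn_integral_mono)
    fix x
    show "indicator ?A x * ?v \<le> (\<integral>\<^sup>+ h. indicator ?A' h * ennreal (f (inverse x * h)) \<partial>\<nu>)"
    proof (cases "x \<in> ?A")
      case True
      have "?v = (\<integral>\<^sup>+ h. ennreal (f (inverse x * h)) \<partial>\<nu>)"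
      proof -
        have "(\<integral>\<^sup>+ h. ennreal (f (inverse x * h)) \<partial>\<nu>) = (\<integral>\<^sup>+ h. ennreal (f h) \<partial>\<nu>)"
          by (rule nn_integral_left_mult[where f = "\<lambda>h. ennreal (f h)"]) measurable
        also have "\<dots> = ?v" unfolding f_def by (simp add: ennreal_indicator)
        finally show ?thesis by simp
      qed
      also have "\<dots> \<le> (\<integral>\<^sup>+ h. indicator ?A' h * ennreal (f (inverse x * h)) \<partial>\<nu>)"
      proof (rule nn_integral_mono)
        fix h
        have "dist (app_isom h p) y \<le> R + E" if "dist (app_isom (inverse x * h) p) p \<le> E"
        proof -
          have "dist (app_isom h p) (app_isom x p) \<le> E"
            using that by (simp add: dist_inverse_isom)
          then show ?thesis using True dist_triangle[of "app_isom h p" y "app_isom x p"] by simp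
        qed
        then show "ennreal (f (inverse x * h)) \<le> indicator ?A' h * ennreal (f (inverse x * h))"
          by (auto simp: f_def indicator_def displacement_def)
      qed
      finally show ?thesis using True by simp
    qed simp
  qed
  also have "\<dots> = (\<integral>\<^sup>+ h. (\<integral>\<^sup>+ x. indicator ?A' h * ennreal (f (inverse x * h)) \<partial>walk_law m n) \<partial>\<nu>)"
    by (rule Fubini'[symmetric]) measurable
  also have "\<dots> = (\<integral>\<^sup>+ h. indicator ?A' h * ?u h \<partial>\<nu>)"
    by (intro nn_integral_cong nn_integral_cmult) measurable
  finally have "(emeasure (walk_law m n) ?A * ?v)\<^sup>2 \<le> (\<integral>\<^sup>+ h. indicator ?A' h * ?u h \<partial>\<nu>)\<^sup>2"
    by (intro power_mono) auto
  also have "\<dots> \<le> (\<integral>\<^sup>+ h. (indicator ?A' h)\<^sup>2 \<partial>\<nu>) * (\<integral>\<^sup>+ h. (?u h)\<^sup>2 \<partial>\<nu>)"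
    by (rule Cauchy_Schwarz_nn_integral) measurable
  also have "(\<integral>\<^sup>+ h. (indicator ?A' h)\<^sup>2 \<partial>\<nu>) = emeasure \<nu> ?A'"
  proof -
    have "(indicator ?A' h)\<^sup>2 = (indicator ?A' h :: ennreal)" for h by (simp add: indicator_def)
    then show ?thesis by simp
  qed
  also have "emeasure \<nu> ?A' * (\<integral>\<^sup>+ h. (?u h)\<^sup>2 \<partial>\<nu>) \<le> emeasure \<nu> ?A' * (ennreal (\<rho>\<^sup>2 ^ n) * ?v)"
    using spectral_gap_iterate[OF bp gap \<rho> f, of n] vf unfolding nnf
    by (intro mult_left_mono) (auto simp: f_def indicator_def)
  finally have le: "(emeasure (walk_law m n) ?A)\<^sup>2 * ?v * ?v \<le> (ennreal (\<rho>\<^sup>2 ^ n) * emeasure \<nu> ?A') * ?v"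
    by (simp add: power2_eq_square mult_ac)
  show ?thesis
  proof (cases "?v = 0")
    case False
    then show ?thesis using le vf ennreal_mult_le_mult_iff[of ?v "(emeasure (walk_law m n) ?A)\<^sup>2 * ?v" "ennreal (\<rho>\<^sup>2 ^ n) * emeasure \<nu> ?A'"]
      by (simp add: mult.commute less_top)
  qed simp
qed

end

section \<open>Lazy walks\<close>

text \<open>\<open>lazy\<close> is given by a set function through \<open>measure_of\<close>, whose
  values are the intended ones only if that function is countably additive. Tossing a coin between
  the identity and an increment of law \<mu> realises it as an honest image measure.\<close>

lemma lazy_eq_distr:
  fixes \<mu> :: "'a::metric_space isom measure"
  assumes bp: "borel_prob \<mu>" and r: "0 \<le> r" "r \<le> 1"
  shows "lazy r \<mu> = distr (measure_pmf (bernoulli_pmf r) \<Otimes>\<^sub>M \<mu>) borel (\<lambda>z. if fst z then 1 else snd z)"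
    (is "_ = ?D")
    and "f \<in> borel_measurable borel \<Longrightarrow>
      (\<integral>\<^sup>+ g. f g \<partial>lazy r \<mu>) = ennreal r * f 1 + ennreal (1 - r) * (\<integral>\<^sup>+ g. f g \<partial>\<mu>)"
proof -
  interpret m: prob_space \<mu> by (rule borel_probD[OF bp])
  note [measurable_cong] = borel_probD(2)[OF bp]
  have [measurable]: "(\<lambda>z. if fst z then 1 else snd z) \<in> measure_pmf (bernoulli_pmf r) \<Otimes>\<^sub>M \<mu> \<rightarrow>\<^sub>M borel"
  proof -
    have "(\<lambda>z. if fst z then (1 :: 'a isom) else snd z) \<in> count_space UNIV \<Otimes>\<^sub>M \<mu> \<rightarrow>\<^sub>M borel" by measurable
    then show ?thesis
      using measurable_cong_sets[OF sets_pair_measure_cong[OF sets_measure_pmf_count_space refl] refl] by blast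
  qed
  have nn: "(\<integral>\<^sup>+ g. f g \<partial>?D) = ennreal r * f 1 + ennreal (1 - r) * (\<integral>\<^sup>+ g. f g \<partial>\<mu>)"
    if [measurable]: "f \<in> borel_measurable borel" for f
  proof -
    have "(\<integral>\<^sup>+ g. f g \<partial>?D) = (\<integral>\<^sup>+ z. f (if fst z then 1 else snd z) \<partial>(measure_pmf (bernoulli_pmf r) \<Otimes>\<^sub>M \<mu>))"
      by (rule nn_integral_distr) measurable
    also have "\<dots> = (\<integral>\<^sup>+ b. (\<integral>\<^sup>+ g. f (if b then 1 else g) \<partial>\<mu>) \<partial>measure_pmf (bernoulli_pmf r))"
      by (subst m.nn_integral_fst[symmetric]) (auto cong: if_cong)
    also have "\<dots> = ennreal r * f 1 + ennreal (1 - r) * (\<integral>\<^sup>+ g. f g \<partial>\<mu>)"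
      using r by (subst nn_integral_bernoulli_pmf) (auto simp: m.emeasure_space_1 mult.commute)
    finally show ?thesis .
  qed
  have em: "emeasure ?D A = ennreal r * emeasure (return borel 1) A + ennreal (1 - r) * emeasure \<mu> A"
    if A [measurable]: "A \<in> sets borel" for A
    using nn[of "indicator A"] A borel_probD(2)[OF bp] by simp
  have "lazy r \<mu> = measure_of (space ?D) (sets ?D) (emeasure ?D)"
    unfolding lazy_def space_distr sets_distr space_borel
  proof (rule measure_of_eq)
    show "sets (borel :: 'a isom measure) \<subseteq> Pow UNIV" by simp
    fix A :: "'a isom set" assume "A \<in> sigma_sets UNIV (sets borel)"
    then have "A \<in> sets borel" using sets.sigma_sets_eq[of "borel :: 'a isom measure"] by simp
    then show "ennreal r * emeasure (return borel 1) A + ennreal (1 - r) * emeasure \<mu> A = emeasure ?D A"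
      by (simp only: em)
  qed
  then show eq: "lazy r \<mu> = ?D" by (simp only: measure_of_of_measure)
  show "(\<integral>\<^sup>+ g. f g \<partial>lazy r \<mu>) = ennreal r * f 1 + ennreal (1 - r) * (\<integral>\<^sup>+ g. f g \<partial>\<mu>)"
    if "f \<in> borel_measurable borel"
    unfolding eq by (rule nn[OF that])
qed

lemma borel_prob_lazy:
  assumes bp: "borel_prob \<mu>" and r: "0 \<le> r" "r \<le> 1"
  shows "borel_prob (lazy r \<mu>)"
proof -
  have "sets (lazy r \<mu>) = sets borel" "space (lazy r \<mu>) = UNIV" unfolding lazy_eq_distr(1)[OF assms] by simp_all
  moreover have "emeasure (lazy r \<mu>) UNIV = 1"
    using lazy_eq_distr(2)[OF assms, of "\<lambda>_. 1"] r borel_probD[OF bp] calculation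
      prob_space.emeasure_space_1[of \<mu>] by (simp flip: ennreal_plus)
  ultimately show ?thesis unfolding borel_prob_def by (auto intro: prob_spaceI)
qed

lemma AE_lazy_displacement:
  assumes bp: "borel_prob \<mu>" and r: "0 \<le> r" "r \<le> 1" and "B \<ge> 0" and "AE g in \<mu>. displacement p g \<le> B"
  shows "AE g in lazy r \<mu>. displacement p g \<le> B"
proof -
  let ?A = "{g. \<not> displacement p g \<le> B}"
  have A: "?A \<in> sets borel" by measurable
  have "emeasure \<mu> ?A = 0"
    using assms(5) borel_probD[OF bp] A by (simp add: AE_iff_measurable[of ?A \<mu>])
  then have "emeasure (lazy r \<mu>) ?A = 0"
    using lazy_eq_distr(2)[OF bp r, of "indicator ?A"] A \<open>B \<ge> 0\<close> borel_probD[OF bp]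
      borel_probD[OF borel_prob_lazy[OF bp r]] by simp
  then show ?thesis
    using A borel_probD[OF borel_prob_lazy[OF bp r]] by (subst AE_iff_measurable[of ?A]) auto
qed

context isom_walk
begin

text \<open>The two Green functions are in fact proportional.\<close>

lemma green_le_lazy_green:
  assumes r: "0 \<le> r" "r < 1"
  shows "f \<in> borel_measurable borel \<Longrightarrow> (\<Sum>i. \<integral>\<^sup>+ h. f h \<partial>walk_law (lazy r \<mu>) i) < \<infinity> \<Longrightarrow>
    (\<Sum>j<n. \<integral>\<^sup>+ h. f h \<partial>walk_law \<mu> j) \<le> ennreal (1 - r) * (\<Sum>i. \<integral>\<^sup>+ h. f h \<partial>walk_law (lazy r \<mu>) i)"
proof (induction n arbitrary: f)
  case (Suc n)
  note [measurable] = Suc.prems(1)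
  have r1: "r \<le> 1" using r by simp
  interpret Z: isom_walk "lazy r \<mu>"
    by unfold_locales (rule pm borel_prob_lazy[OF bp r(1) r1])+
  let ?G = "\<lambda>f. \<Sum>i. \<integral>\<^sup>+ h. f h \<partial>walk_law (lazy r \<mu>) i"
  \<comment> \<open>The Markov operator of \<mu> applied to \<open>f\<close>: one further increment
    is averaged out. The induction is over all \<open>f\<close> because it passes to
    \<open>u\<close>.\<close>
  define u where "u h = (\<integral>\<^sup>+ g. f (h * g) \<partial>\<mu>)" for h
  have [measurable]: "u \<in> borel_measurable borel" unfolding u_def by measurable
  have walk: "(\<integral>\<^sup>+ h. f h \<partial>walk_law \<mu> (Suc j)) = (\<integral>\<^sup>+ h. u h \<partial>walk_law \<mu> j)" for j
    using nn_integral_walk_law_add[of f j "Suc 0"] by (simp add: walk_law_1 u_def)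
  have lwalk: "(\<integral>\<^sup>+ h. f h \<partial>walk_law (lazy r \<mu>) (Suc j)) =
      ennreal r * (\<integral>\<^sup>+ h. f h \<partial>walk_law (lazy r \<mu>) j)
      + ennreal (1 - r) * (\<integral>\<^sup>+ h. u h \<partial>walk_law (lazy r \<mu>) j)" for j
  proof -
    have "(\<integral>\<^sup>+ h. f h \<partial>walk_law (lazy r \<mu>) (Suc j))
        = (\<integral>\<^sup>+ h. (\<integral>\<^sup>+ g. f (h * g) \<partial>lazy r \<mu>) \<partial>walk_law (lazy r \<mu>) j)"
      using Z.nn_integral_walk_law_add[of f j "Suc 0"] by (simp add: Z.walk_law_1)
    also have "\<dots> = (\<integral>\<^sup>+ h. ennreal r * f h + ennreal (1 - r) * u h \<partial>walk_law (lazy r \<mu>) j)"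
      by (intro nn_integral_cong, subst lazy_eq_distr(2)[OF bp r(1) r1]) (auto simp: u_def)
    also have "\<dots> = ennreal r * (\<integral>\<^sup>+ h. f h \<partial>walk_law (lazy r \<mu>) j)
      + ennreal (1 - r) * (\<integral>\<^sup>+ h. u h \<partial>walk_law (lazy r \<mu>) j)"
      by (simp add: nn_integral_add nn_integral_cmult)
    finally show ?thesis .
  qed
  have "?G f = f 1 + (\<Sum>i. \<integral>\<^sup>+ h. f h \<partial>walk_law (lazy r \<mu>) (Suc i))"
    using sums_Suc[OF summable_sums[OF summableI[of "\<lambda>i. \<integral>\<^sup>+ h. f h \<partial>walk_law (lazy r \<mu>) (Suc i)"]]]
    by (simp add: Z.walk_law_0 nn_integral_return sums_iff add.commute)
  also have "(\<Sum>i. \<integral>\<^sup>+ h. f h \<partial>walk_law (lazy r \<mu>) (Suc i)) = ennreal r * ?G f + ennreal (1 - r) * ?G u"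
    unfolding lwalk by (simp add: suminf_add[symmetric] ennreal_suminf_cmult summableI)
  \<comment> \<open>The Green equation of the lazy walk: the visit at time 0, then either a pause or
    a genuine step.\<close>
  finally have G1: "?G f = ennreal r * ?G f + (f 1 + ennreal (1 - r) * ?G u)"
    by (simp add: add_ac)
  have "ennreal r * ?G f + ennreal (1 - r) * ?G f = ennreal (r + (1 - r)) * ?G f"
    using r by (subst ennreal_plus) (auto simp: distrib_right)
  then have G2: "?G f = ennreal r * ?G f + ennreal (1 - r) * ?G f" by simp
  \<comment> \<open>Cancelling the pauses on both sides is legitimate only because the lazy Green
    function is finite.\<close>
  have "ennreal r * ?G f \<noteq> \<infinity>" using Suc.prems(2) by (simp add: ennreal_mult_eq_top_iff)
  then have eq: "ennreal (1 - r) * ?G f = f 1 + ennreal (1 - r) * ?G u"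
    using G1 G2 by (metis ennreal_add_left_cancel infinity_ennreal_def)
  have "ennreal (1 - r) * ?G u \<le> ennreal (1 - r) * ?G f" unfolding eq by simp
  also have "\<dots> < \<infinity>" using Suc.prems(2) by (simp add: ennreal_mult_less_top)
  finally have "ennreal (1 - r) * ?G u < \<infinity>" .
  then have Gu: "?G u < \<infinity>" using r by (auto simp: ennreal_mult_less_top)
  have "(\<Sum>j<Suc n. \<integral>\<^sup>+ h. f h \<partial>walk_law \<mu> j) = f 1 + (\<Sum>j<n. \<integral>\<^sup>+ h. u h \<partial>walk_law \<mu> j)"
    by (subst sum.lessThan_Suc_shift) (simp add: walk_law_0 nn_integral_return walk)
  also have "\<dots> \<le> f 1 + ennreal (1 - r) * ?G u"
    using Suc.IH[of u] Gu by (intro add_left_mono) auto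
  finally show ?case unfolding eq .
qed simp

end

section \<open>Gromov products along the walk\<close>

lemma gromov_product_nonneg: "0 \<le> gromov_product p x y"
  using dist_triangle3[of x y p] by (simp add: gromov_product_def dist_commute)

lemma gromov_product_le: "gromov_product p x y \<le> dist y p" "gromov_product p x y \<le> dist x p"
  using dist_triangle[of x p y] dist_triangle3[of y p x] by (simp_all add: gromov_product_def dist_commute)

context haar_isom
begin

text \<open>\<open>hitting_le_volume\<close> with the volume made explicit. The constants depend on
  the group and the base point alone, not on the measure, the target or the time.\<close>

lemma hitting_decay:
  assumes geo: "geodesic_metric TYPE('a)" and coc: "isom_cocompact TYPE('a)"
  obtains C L where "C \<ge> 0" "L \<ge> 0"
    "\<And>m \<rho> n y R. borel_prob m \<Longrightarrow> left_regular_norm \<nu> m \<le> \<rho> \<Longrightarrow> 0 \<le> \<rho> \<Longrightarrow> 0 \<le> R \<Longrightarrow>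
      emeasure (walk_law m n) {x. dist (app_isom x p) y \<le> R} \<le> ennreal (C * exp (L * R) * \<rho> ^ n)"
proof -
  obtain D where D: "D \<ge> 0" "\<And>y. \<exists>g. dist (app_isom g p) y \<le> D"
    by (rule cocompact_orbit_dense[OF coc, of p]) blast
  obtain N V where NV: "N \<ge> 1" "V \<ge> 0"
    "\<And>R. R \<ge> 0 \<Longrightarrow> emeasure \<nu> {g. displacement p g \<le> R} \<le> ennreal (V * N powr R)"
    using volume_growth[OF geo D] by metis
  obtain E where E: "E \<ge> 0" "emeasure \<nu> {g. displacement p g \<le> E} > 0"
    using emeasure_displacement_pos by metis
  define v where "v = enn2real (emeasure \<nu> {g. displacement p g \<le> E})"
  have v: "emeasure \<nu> {g. displacement p g \<le> E} = ennreal v" "v > 0"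
    using emeasure_displacement_finite[of E] E(2) by (auto simp: v_def enn2real_positive_iff)
  \<comment> \<open>The squared probability is bounded by a volume, so both constants come from a
    square root: hence the root here and half of \<open>ln N\<close> below.\<close>
  define C where "C = sqrt (V / v * N powr (E + D))"
  define L where "L = ln N / 2"
  show thesis
  proof (rule that)
    show "C \<ge> 0" "L \<ge> 0" using NV v by (auto simp: C_def L_def)
    fix m :: "'a isom measure" and \<rho> R :: real and n y
    assume bp: "borel_prob m" and gap: "left_regular_norm \<nu> m \<le> \<rho>" and \<rho>: "0 \<le> \<rho>" and R: "0 \<le> R"
    interpret W: isom_walk m by unfold_locales (rule pm bp)+
    define a where "a = W.L.prob n {x. dist (app_isom x p) y \<le> R}"
    have a: "emeasure (walk_law m n) {x. dist (app_isom x p) y \<le> R} = ennreal a" "a \<ge> 0"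
      by (simp_all add: a_def W.L.emeasure_eq_measure)
    obtain g where g: "dist (app_isom g p) y \<le> D" using D by blast
    \<comment> \<open>An arbitrary centre is replaced by an orbit point within \<open>D\<close>,
      whose ball is a left translate of a displacement ball.\<close>
    have "emeasure \<nu> {h. dist (app_isom h p) y \<le> R + E}
        \<le> emeasure \<nu> {h. displacement p (inverse g * h) \<le> R + E + D}"
    proof (rule emeasure_mono)
      show "{h. dist (app_isom h p) y \<le> R + E} \<subseteq> {h. displacement p (inverse g * h) \<le> R + E + D}"
      proof safe
        fix h assume "dist (app_isom h p) y \<le> R + E"
        then show "displacement p (inverse g * h) \<le> R + E + D"
          using g dist_triangle[of "app_isom h p" "app_isom g p" y]
          by (simp add: displacement_def dist_inverse_isom dist_commute[of y])
      qed
    qed measurable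
    also have "\<dots> \<le> ennreal (V * N powr (R + E + D))"
      unfolding emeasure_translate using R E D by (intro NV(3)) simp
    finally have vol: "emeasure \<nu> {h. dist (app_isom h p) y \<le> R + E} \<le> ennreal (V * N powr (R + E + D))" .
    have "(ennreal a)\<^sup>2 * ennreal v \<le> ennreal (\<rho>\<^sup>2 ^ n) * emeasure \<nu> {h. dist (app_isom h p) y \<le> R + E}"
      using hitting_le_volume[OF bp gap \<rho>, of n y R E] unfolding a v .
    also have "\<dots> \<le> ennreal (\<rho>\<^sup>2 ^ n) * ennreal (V * N powr (R + E + D))"
      by (intro mult_left_mono vol) simp
    finally have "ennreal (a\<^sup>2 * v) \<le> ennreal (\<rho>\<^sup>2 ^ n * (V * N powr (R + E + D)))"
      using a(2) v(2) NV(2) \<rho> by (simp add: ennreal_mult ennreal_power)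
    then have "a\<^sup>2 * v \<le> \<rho>\<^sup>2 ^ n * (V * N powr (R + E + D))"
      using NV \<rho> by (subst (asm) ennreal_le_iff) auto
    also have "\<dots> = v * (\<rho> ^ n)\<^sup>2 * (V / v * N powr (E + D)) * N powr R"
      using v(2) by (simp add: powr_add mult_ac flip: power_mult)
    also have "N powr R = (exp (L * R))\<^sup>2"
      using NV(1) by (simp add: L_def powr_def mult_ac flip: exp_double)
    also have "V / v * N powr (E + D) = C\<^sup>2" unfolding C_def using NV v by simp
    finally have "v * a\<^sup>2 \<le> v * (C * exp (L * R) * \<rho> ^ n)\<^sup>2"
      by (simp add: power_mult_distrib mult_ac)
    then have "a\<^sup>2 \<le> (C * exp (L * R) * \<rho> ^ n)\<^sup>2" using v(2) by simp
    then have "a \<le> C * exp (L * R) * \<rho> ^ n"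
      using \<open>C \<ge> 0\<close> \<rho> by (intro power2_le_imp_le[of a]) auto
    then show "emeasure (walk_law m n) {x. dist (app_isom x p) y \<le> R} \<le> ennreal (C * exp (L * R) * \<rho> ^ n)"
      unfolding a by (rule ennreal_leI)
  qed
qed

text \<open>With steps of length at most \<open>B\<close>, the ball cannot be reached before time
  \<open>(dist p y - R) / B\<close>. The decay rate is written as a square so that one factor
  \<sigma> pays for this delay and the other sums as a geometric series. The bound is uniform in
  \<open>n\<close> and \<open>r\<close>.\<close>

lemma visits_le:
  assumes bp: "borel_prob \<mu>" and r: "0 \<le> r" "r < 1" and \<sigma>: "0 < \<sigma>" "\<sigma> < 1"
    and B: "B > 0" "AE g in \<mu>. displacement p g \<le> B" and "c \<ge> 0"
    and hit: "\<And>n. emeasure (walk_law (lazy r \<mu>) n) {x. dist (app_isom x p) y \<le> R} \<le> ennreal (c * (\<sigma>\<^sup>2) ^ n)"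
  shows "(\<Sum>i<n. emeasure (walk_law \<mu> i) {x. dist (app_isom x p) y \<le> R})
    \<le> ennreal (c * \<sigma> powr ((dist p y - R) / B) / (1 - \<sigma>))"
proof -
  interpret W: isom_walk \<mu> by unfold_locales (rule pm bp)+
  have r1: "r \<le> 1" using r by simp
  interpret Z: isom_walk "lazy r \<mu>"
    by unfold_locales (rule pm borel_prob_lazy[OF bp r(1) r1])+
  let ?A = "{x. dist (app_isom x p) y \<le> R}"
  have [measurable]: "?A \<in> sets borel" by measurable
  let ?u = "\<sigma> powr ((dist p y - R) / B)"
  have le: "emeasure (walk_law (lazy r \<mu>) i) ?A \<le> ennreal (c * ?u * \<sigma> ^ i)" for i
  proof (cases "real i * B < dist p y - R")
    case True
    have "AE g in walk_law (lazy r \<mu>) i. displacement p g \<le> real i * B"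
      using B by (intro Z.AE_displacement_walk_law AE_lazy_displacement[OF bp r(1) r1]) auto
    then have "AE g in walk_law (lazy r \<mu>) i. g \<notin> ?A"
    proof eventually_elim
      case (elim g)
      show ?case
        using True elim dist_triangle[of p y "app_isom g p"] by (simp add: displacement_def dist_commute)
    qed
    then have "emeasure (walk_law (lazy r \<mu>) i) ?A = 0"
      by (subst (asm) AE_iff_measurable[of ?A]) auto
    then show ?thesis by simp
  next
    case False
    \<comment> \<open>From the first possible visit on, one of the two factors is frozen at its
      value at that time.\<close>
    have "c * (\<sigma>\<^sup>2) ^ i = c * \<sigma> powr real i * \<sigma> ^ i"
      using \<sigma> by (simp add: powr_realpow power2_eq_square power_mult_distrib)
    also have "\<dots> \<le> c * ?u * \<sigma> ^ i"
      using False B \<sigma> \<open>c \<ge> 0\<close>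
      by (intro mult_right_mono mult_left_mono powr_mono') (auto simp: field_simps)
    finally show ?thesis using hit[of i] by (meson ennreal_leI order_trans)
  qed
  have sums: "(\<lambda>i. c * ?u * \<sigma> ^ i) sums (c * ?u * (1 / (1 - \<sigma>)))"
    using \<sigma> by (intro sums_mult geometric_sums) auto
  have "(\<Sum>i. emeasure (walk_law (lazy r \<mu>) i) ?A) \<le> (\<Sum>i. ennreal (c * ?u * \<sigma> ^ i))"
    by (intro suminf_le le summableI)
  also have "\<dots> = ennreal (c * ?u * (1 / (1 - \<sigma>)))"
    using sums \<open>c \<ge> 0\<close> \<sigma> by (subst suminf_ennreal2) (auto simp: sums_iff)
  finally have G: "(\<Sum>i. emeasure (walk_law (lazy r \<mu>) i) ?A) \<le> ennreal (c * ?u / (1 - \<sigma>))" by simp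
  have "(\<Sum>i<n. emeasure (walk_law \<mu> i) ?A) \<le> ennreal (1 - r) * (\<Sum>i. emeasure (walk_law (lazy r \<mu>) i) ?A)"
    using W.green_le_lazy_green[OF r, of "indicator ?A" n] le_less_trans[OF G]
    by simp
  also have "\<dots> \<le> 1 * (\<Sum>i. emeasure (walk_law (lazy r \<mu>) i) ?A)"
    using r by (intro mult_right_mono) auto
  finally show ?thesis using G by simp
qed

text \<open>\<open>path_passes_near\<close> applied to almost every trajectory, followed by a union
  bound over times. The point \<open>y\<close> is fixed on a geodesic from \<open>p\<close> to
  \<open>x\<close> in advance and so does not depend on the trajectory.\<close>

lemma shadow_le_visits:
  assumes geo: "geodesic_metric TYPE('a)"
    and hyp: "\<And>x y z p :: 'a. min (gromov_product p x z) (gromov_product p z y) - \<delta> \<le> gromov_product p x y"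
    and \<delta>: "\<delta> \<ge> 0" and bp: "borel_prob \<mu>"
    and B: "AE g in \<mu>. displacement p g \<le> B" and t: "0 \<le> t" "t \<le> dist p x"
  obtains y where "dist p y = t"
    "emeasure (walk_law \<mu> (2 ^ k)) {h. t \<le> gromov_product p x (app_isom h p)}
      \<le> (\<Sum>i<2 ^ k. emeasure (walk_law \<mu> i) {h. dist (app_isom h p) y \<le> (real k + 1) * \<delta> + B})"
proof -
  interpret W: isom_walk \<mu> by unfold_locales (rule pm bp)+
  let ?X = "\<lambda>n \<omega>. prod_list (map \<omega> [0..<n])"
  let ?R = "(real k + 1) * \<delta> + B"
  obtain y where y: "dist p y = t" "dist y x = dist p x - t"
    using geodesic_point[OF geo t] by metis
  have [measurable]: "{h. t \<le> gromov_product p x (app_isom h p)} \<in> sets borel"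
    unfolding gromov_product_def dist_commute[of x] by measurable
  let ?V = "\<lambda>i. {\<omega>\<in>space W.S. dist (app_isom (?X i \<omega>) p) y \<le> ?R}"
  have "AE \<omega> in W.S. \<forall>i. displacement p (\<omega> i) \<le> B" by (rule W.AE_component[OF B])
  then have "AE \<omega> in W.S. \<omega> \<in> {\<omega>\<in>space W.S. t \<le> gromov_product p x (app_isom (?X (2 ^ k) \<omega>) p)} \<longrightarrow>
      \<omega> \<in> (\<Union>i<2 ^ k. ?V i)"
  proof eventually_elim
    case (elim \<omega>)
    show ?case
    proof
      assume "\<omega> \<in> {\<omega>\<in>space W.S. t \<le> gromov_product p x (app_isom (?X (2 ^ k) \<omega>) p)}"
      then have \<omega>: "\<omega> \<in> space W.S" "t \<le> gromov_product p x (app_isom (?X (2 ^ k) \<omega>) p)" by auto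
      have step: "dist (app_isom (?X i \<omega>) p) (app_isom (?X (Suc i) \<omega>) p) \<le> B" for i
        using elim by (simp add: displacement_def dist_commute)
      have "\<exists>i<2 ^ k. dist (app_isom (?X i \<omega>) p) y \<le> ?R"
        by (rule path_passes_near[OF hyp \<delta> y _ \<omega>(2) step]) auto
      then show "\<omega> \<in> (\<Union>i<2 ^ k. ?V i)" using \<omega>(1) by auto
    qed
  qed
  then have "emeasure W.S {\<omega>\<in>space W.S. t \<le> gromov_product p x (app_isom (?X (2 ^ k) \<omega>) p)}
      \<le> emeasure W.S (\<Union>i<2 ^ k. ?V i)"
    by (rule emeasure_mono_AE) measurable
  also have "\<dots> \<le> (\<Sum>i<2 ^ k. emeasure W.S (?V i))"
    by (intro emeasure_subadditive_finite) auto
  also have "\<dots> = (\<Sum>i<2 ^ k. emeasure (walk_law \<mu> i) {h. dist (app_isom h p) y \<le> ?R})"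
    unfolding walk_law_def
    by (intro sum.cong refl, subst emeasure_distr) (auto intro!: arg_cong[where f = "emeasure W.S"])
  also have "emeasure W.S {\<omega>\<in>space W.S. t \<le> gromov_product p x (app_isom (?X (2 ^ k) \<omega>) p)}
      = emeasure (walk_law \<mu> (2 ^ k)) {h. t \<le> gromov_product p x (app_isom h p)}"
    unfolding walk_law_def
    by (subst emeasure_distr) (auto intro!: arg_cong[where f = "emeasure W.S"])
  finally show thesis using that[OF y(1)] by blast
qed

text \<open>The mean is split at the threshold k^2: below it the product contributes at most k^2,
  above it at most the maximal displacement \<open>2 ^ k * B\<close> times the probability of the
  shadow.\<close>

lemma gromov_product_expectation:
  assumes geo: "geodesic_metric TYPE('a)" and coc: "isom_cocompact TYPE('a)"
    and hyp: "gromov_hyperbolic TYPE('a)" and B: "B > 0" and \<rho>: "0 < \<rho>" "\<rho> < 1"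
  obtains \<eta> :: "nat \<Rightarrow> real" where "(\<lambda>k. \<eta> k / 2 ^ k) \<longlonglongrightarrow> 0"
    "\<And>\<mu> r k x. borel_prob \<mu> \<Longrightarrow> AE g in \<mu>. displacement p g \<le> B \<Longrightarrow> 0 \<le> r \<Longrightarrow> r < 1 \<Longrightarrow>
      left_regular_norm \<nu> (lazy r \<mu>) \<le> \<rho> \<Longrightarrow>
      (\<integral>h. gromov_product p x (app_isom h p) \<partial>walk_law \<mu> (2 ^ k)) \<le> \<eta> k"
proof -
  obtain \<delta> where \<delta>: "\<delta> \<ge> 0"
    and hyp': "\<And>x y z p :: 'a. min (gromov_product p x z) (gromov_product p z y) - \<delta> \<le> gromov_product p x y"
    using hyp unfolding gromov_hyperbolic_def by auto
  obtain C L where CL: "C \<ge> 0" "L \<ge> 0"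
    and hit: "\<And>m \<rho> n y R. borel_prob m \<Longrightarrow> left_regular_norm \<nu> m \<le> \<rho> \<Longrightarrow> 0 \<le> \<rho> \<Longrightarrow> 0 \<le> R \<Longrightarrow>
      emeasure (walk_law m n) {x. dist (app_isom x p) y \<le> R} \<le> ennreal (C * exp (L * R) * \<rho> ^ n)"
    by (rule hitting_decay[OF geo coc]) blast
  define \<sigma> where "\<sigma> = sqrt \<rho>"
  have \<sigma>: "0 < \<sigma>" "\<sigma> < 1" "\<sigma>\<^sup>2 = \<rho>" using \<rho> by (auto simp: \<sigma>_def)
  define s where "s = - ln \<sigma>"
  have s: "s > 0" using \<sigma> by (simp add: s_def)
  \<comment> \<open>\<open>R k\<close> is the radius from \<open>shadow_le_visits\<close>,
    \<open>P k\<close> the resulting bound on the shadow's probability, with \<sigma> rewritten as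
    \<open>exp (- s)\<close>.\<close>
  define R where "R k = (real k + 1) * \<delta> + B" for k
  define P where "P k = C * exp (L * R k) * exp (- s * ((real k)\<^sup>2 - R k) / B) / (1 - \<sigma>)" for k
  define \<eta> where "\<eta> k = (real k)\<^sup>2 + 2 ^ k * B * P k" for k
  have P0: "P k \<ge> 0" for k using CL \<sigma> by (simp add: P_def)
  show thesis
  proof (rule that)
    have sB: "s / B > 0" using s B by simp
    have "(\<lambda>k. exp (L * R k) * exp (- s * ((real k)\<^sup>2 - R k) / B)) \<longlonglongrightarrow> 0"
    \<comment> \<open>\<open>R k\<close> is affine in \<open>k\<close>, so the exponent is a linear
      term minus a positive multiple of k^2.\<close>
    proof -
      define a where "a = L * \<delta> + s * \<delta> / B"
      define b where "b = (L + s / B) * (\<delta> + B)"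
      define q where "q = s / B"
      have q: "q > 0" using sB by (simp add: q_def)
      have "exp (L * R k) * exp (- s * ((real k)\<^sup>2 - R k) / B) = exp (a * real k + b - q * (real k)\<^sup>2)" for k
        using B unfolding exp_add[symmetric] R_def a_def b_def q_def
        by (simp add: field_simps power2_eq_square)
      moreover have "(\<lambda>k :: nat. exp (a * real k + b - q * (real k)\<^sup>2)) \<longlonglongrightarrow> 0"
        using q by real_asymp
      ultimately show ?thesis by simp
    qed
    from tendsto_mult_left[OF this, of "C / (1 - \<sigma>)"] have "P \<longlonglongrightarrow> 0"
      by (simp add: P_def[abs_def] mult_ac)
    moreover have "(\<lambda>k :: nat. (real k)\<^sup>2 / 2 ^ k) \<longlonglongrightarrow> 0" by real_asymp
    ultimately have "(\<lambda>k. (real k)\<^sup>2 / 2 ^ k + B * P k) \<longlonglongrightarrow> 0 + B * 0"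
      by (intro tendsto_intros)
    then show "(\<lambda>k. \<eta> k / 2 ^ k) \<longlonglongrightarrow> 0"
      by (simp add: \<eta>_def add_divide_distrib mult.assoc)
  next
    fix \<mu> r k x
    assume bp: "borel_prob \<mu>" and BB: "AE g in \<mu>. displacement p g \<le> B" and r: "0 \<le> r" "r < 1"
      and gap: "left_regular_norm \<nu> (lazy r \<mu>) \<le> \<rho>"
    interpret W: isom_walk \<mu> by unfold_locales (rule pm bp)+
    let ?M = "walk_law \<mu> (2 ^ k)" and ?t = "(real k)\<^sup>2"
    let ?gp = "\<lambda>h. gromov_product p x (app_isom h p)"
    have gpm [measurable]: "?gp \<in> borel_measurable borel"
      unfolding gromov_product_def dist_commute[of x] by measurable
    have Rk: "R k \<ge> 0" using \<delta> B by (simp add: R_def)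
    have pr: "emeasure ?M {h. ?t \<le> ?gp h} \<le> ennreal (P k)"
    proof (cases "?t \<le> dist p x")
      case True
      obtain y where y: "dist p y = ?t"
        "emeasure ?M {h. ?t \<le> ?gp h} \<le> (\<Sum>i<2 ^ k. emeasure (walk_law \<mu> i) {h. dist (app_isom h p) y \<le> R k})"
        using shadow_le_visits[OF geo hyp' \<delta> bp BB _ True, of k] unfolding R_def by auto
      have "emeasure (walk_law (lazy r \<mu>) n) {x. dist (app_isom x p) y \<le> R k} \<le> ennreal (C * exp (L * R k) * (\<sigma>\<^sup>2) ^ n)" for n
        using hit[OF borel_prob_lazy[OF bp] gap _ Rk] r \<rho> \<sigma> by simp
      then have "(\<Sum>i<2 ^ k. emeasure (walk_law \<mu> i) {h. dist (app_isom h p) y \<le> R k})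
          \<le> ennreal (C * exp (L * R k) * \<sigma> powr ((dist p y - R k) / B) / (1 - \<sigma>))"
        using CL by (intro visits_le[OF bp r \<sigma>(1,2) B BB]) auto
      also have "\<sigma> powr ((dist p y - R k) / B) = exp (- s * (?t - R k) / B)"
        using \<sigma> by (simp add: powr_def s_def y(1) field_simps)
      finally show ?thesis using y(2) unfolding P_def by (rule order_trans[rotated])
    next
      \<comment> \<open>When \<open>x\<close> is closer to \<open>p\<close> than k^2, the shadow is
        empty, the product being at most \<open>dist x p\<close>.\<close>
      case False
      then have "\<not> ?t \<le> ?gp h" for h
        using gromov_product_le(2)[of p x "app_isom h p"] by (simp add: dist_commute[of p])
      then have "{h. ?t \<le> ?gp h} = {}" by blast
      then show ?thesis by simp
    qed
    have "W.L.prob (2 ^ k) {h. ?t \<le> ?gp h} \<le> P k"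
      using pr P0[of k] by (simp add: W.L.emeasure_eq_measure)
    have kap: "AE h in ?M. displacement p h \<le> 2 ^ k * B"
      using W.AE_displacement_walk_law[OF BB, of "2 ^ k"] by simp
    have ae: "AE h in ?M. ?gp h \<le> 2 ^ k * B"
      using kap
    proof eventually_elim
      case (elim h)
      then show ?case using gromov_product_le(1)[of p x "app_isom h p"] by (simp add: displacement_def)
    qed
    have int: "integrable ?M ?gp"
      using ae by (intro W.L.integrable_const_bound[where B = "2 ^ k * B"])
        (simp_all add: gromov_product_nonneg abs_of_nonneg gpm)
    have "(\<integral>h. ?gp h \<partial>?M) \<le> (\<integral>h. ?t + 2 ^ k * B * indicator {h. ?t \<le> ?gp h} h \<partial>?M)"
    proof (rule integral_mono_AE[OF int])
      show "AE h in ?M. ?gp h \<le> ?t + 2 ^ k * B * indicator {h. ?t \<le> ?gp h} h"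
        using ae by eventually_elim (auto simp: indicator_def intro: add_increasing)
    qed (intro Bochner_Integration.integrable_add integrable_mult_right W.L.integrable_const
        W.L.integrable_const_bound[where B = 1], auto)
    also have "\<dots> = ?t + 2 ^ k * B * W.L.prob (2 ^ k) {h. ?t \<le> ?gp h}"
    proof -
      have "integrable ?M (indicator {h. ?t \<le> ?gp h} :: _ \<Rightarrow> real)"
        by (intro W.L.integrable_const_bound[where B = 1]) auto
      then show ?thesis using W.L.prob_space[of "2 ^ k"] by simp
    qed
    also have "\<dots> \<le> \<eta> k"
      using \<open>W.L.prob (2 ^ k) {h. ?t \<le> ?gp h} \<le> P k\<close> B by (simp add: \<eta>_def)
    finally show "(\<integral>h. ?gp h \<partial>?M) \<le> \<eta> k" .
  qed
qed

end

section \<open>Drift\<close>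

lemma exp_le_quadratic:
  fixes u :: real
  assumes "\<bar>u\<bar> \<le> 1"
  shows "exp u \<le> 1 + u + 2 * u\<^sup>2"
proof -
  obtain t where t: "\<bar>t\<bar> \<le> \<bar>u\<bar>" "exp u = (\<Sum>m<2. u ^ m / fact m) + exp t / fact 2 * u ^ 2"
    using Maclaurin_exp_le[of u 2] by blast
  have "exp t \<le> exp 1" using t(1) assms by simp
  also have "\<dots> \<le> 3" by (rule exp_le)
  finally have "exp t / 2 * u\<^sup>2 \<le> 2 * u\<^sup>2" by (intro mult_right_mono) auto
  then show ?thesis using t(2) by (simp add: numeral_2_eq_2)
qed

section \<open>Exponential moments of the horofunction cocycle and concentration\<close>

context isom_walk
begin

text \<open>The Busemann cocycle with its boundary point replaced by a point \<open>x\<close> of the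
  space. At \<open>x = p\<close> it is the displacement, so results uniform in \<open>x\<close>
  specialise to the walk.\<close>

definition horo :: "'a \<Rightarrow> 'a \<Rightarrow> 'a isom \<Rightarrow> real"
  where "horo p x h = dist (app_isom h p) x - dist p x"

lemma horo_measurable [measurable]: "horo p x \<in> borel_measurable borel"
  unfolding horo_def by measurable

lemma horo_self: "horo p p h = displacement p h"
  by (simp add: horo_def displacement_def)

lemma abs_horo_le: "\<bar>horo p x h\<bar> \<le> displacement p h"
  using dist_triangle[of "app_isom h p" x p] dist_triangle3[of p x "app_isom h p"]
  by (simp add: horo_def displacement_def dist_commute abs_le_iff)

lemma horo_mult: "horo p x (g * h) = horo p (app_isom (inverse g) x) h + horo p x g"
  using dist_inverse_isom[of g x "app_isom h p"] dist_inverse_isom[of g x p]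
  by (simp add: horo_def dist_commute)

lemma horo_eq: "horo p x h = displacement p h - 2 * gromov_product p x (app_isom h p)"
  by (simp add: horo_def displacement_def gromov_product_def dist_commute field_simps)

text \<open>Conditioning on the first \<open>n\<close> increments splits the exponent by the cocycle
  identity, but the later increments are then seen from a random point; hence both bounds must hold
  for all \<open>x\<close>.\<close>

lemma exp_horo_mult:
  assumes "\<And>x. (\<integral>\<^sup>+ h. ennreal (exp (s * horo p x h)) \<partial>walk_law \<mu> n) \<le> ennreal c"
    and "\<And>x. (\<integral>\<^sup>+ h. ennreal (exp (s * horo p x h)) \<partial>walk_law \<mu> k) \<le> ennreal d" "c \<ge> 0" "d \<ge> 0"
  shows "(\<integral>\<^sup>+ h. ennreal (exp (s * horo p x h)) \<partial>walk_law \<mu> (n + k)) \<le> ennreal (c * d)"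
proof -
  have "(\<integral>\<^sup>+ h. ennreal (exp (s * horo p x h)) \<partial>walk_law \<mu> (n + k))
      = (\<integral>\<^sup>+ g. (\<integral>\<^sup>+ h. ennreal (exp (s * horo p x (g * h))) \<partial>walk_law \<mu> k) \<partial>walk_law \<mu> n)"
    by (rule nn_integral_walk_law_add) measurable
  also have "\<dots> = (\<integral>\<^sup>+ g. (\<integral>\<^sup>+ h. ennreal (exp (s * horo p x g)) *
      ennreal (exp (s * horo p (app_isom (inverse g) x) h)) \<partial>walk_law \<mu> k) \<partial>walk_law \<mu> n)"
    by (intro nn_integral_cong) (simp add: horo_mult distrib_left exp_add ennreal_mult mult.commute)
  also have "\<dots> = (\<integral>\<^sup>+ g. ennreal (exp (s * horo p x g)) *
      (\<integral>\<^sup>+ h. ennreal (exp (s * horo p (app_isom (inverse g) x) h)) \<partial>walk_law \<mu> k) \<partial>walk_law \<mu> n)"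
    by (intro nn_integral_cong nn_integral_cmult) measurable
  also have "\<dots> \<le> (\<integral>\<^sup>+ g. ennreal (exp (s * horo p x g)) * ennreal d \<partial>walk_law \<mu> n)"
    by (intro nn_integral_mono mult_left_mono assms(2)) simp
  also have "\<dots> = (\<integral>\<^sup>+ g. ennreal (exp (s * horo p x g)) \<partial>walk_law \<mu> n) * ennreal d"
    by (rule nn_integral_multc) measurable
  also have "\<dots> \<le> ennreal c * ennreal d" by (intro mult_right_mono assms(1)) simp
  finally show ?thesis using assms(3,4) by (simp add: ennreal_mult)
qed

text \<open>Changing one factor of the random product is not a bounded perturbation, so the
  concentration comes from the cocycle \<open>horo\<close>, whose exponential moments, taken uniformly in \<open>x\<close>,
  are submultiplicative.\<close>

lemma eventually_displacement_less:
  assumes B: "B > 0" "AE g in \<mu>. displacement p g \<le> B" and e: "\<bar>e\<bar> = 1" and N: "N \<ge> 1"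
    and w: "\<And>x. e * (\<integral>h. horo p x h \<partial>walk_law \<mu> N) \<le> w" and v: "w / real N < v"
  shows "AE \<omega> in S. eventually (\<lambda>n. e * (displacement p (prod_list (map \<omega> [0..<n])) / real n) < v) sequentially"
proof -
  have kap: "AE h in walk_law \<mu> n. displacement p h \<le> real n * B" for n
    by (rule AE_displacement_walk_law[OF B(2)])
  define b where "b = B * real N"
  have b: "b > 0" using B N by (simp add: b_def)
  define gap where "gap = real N * v - w"
  have gap: "gap > 0" using v N by (simp add: gap_def field_simps)
  \<comment> \<open>The first bound keeps exponents within 1, where the quadratic estimate of exp
    holds; the second makes the quadratic error at most half of the linear gain
    \<open>gap\<close>.\<close>
  define s where "s = min (1 / b) (gap / (4 * b\<^sup>2))"
  have s: "s > 0" "s * b \<le> 1" "4 * s * b\<^sup>2 \<le> gap"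
    using b gap by (auto simp: s_def min_def field_simps)
  \<comment> \<open>\<open>c\<close> bounds the logarithm of the exponential moment of a block of
    \<open>N\<close> increments; \<theta> is the exponential gain per block in Markov's
    inequality.\<close>
  define c where "c = s * w + 2 * (s * b)\<^sup>2"
  define \<theta> where "\<theta> = s * (real N * v) - c"
  have \<theta>: "\<theta> > 0"
  proof -
    have "\<theta> = s * (gap - 2 * s * b\<^sup>2)"
      by (simp add: \<theta>_def c_def gap_def power2_eq_square algebra_simps)
    also have "\<dots> > 0" using s gap b by (intro mult_pos_pos) auto
    finally show ?thesis .
  qed
  have abs_e: "\<bar>s * e * horo p x h\<bar> \<le> s * displacement p h" for x h
    using abs_horo_le[of p x h] e s by (simp add: abs_mult)
  have step: "(\<integral>\<^sup>+ h. ennreal (exp (s * e * horo p x h)) \<partial>walk_law \<mu> N) \<le> ennreal (exp c)" for x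
  proof -
    have u: "AE h in walk_law \<mu> N. \<bar>s * e * horo p x h\<bar> \<le> s * b"
      using kap[of N]
    proof eventually_elim
      case (elim h)
      then have "s * displacement p h \<le> s * b" using s by (simp add: b_def mult.commute)
      then show ?case using abs_e[of x h] by simp
    qed
    have h: "AE h in walk_law \<mu> N. \<bar>horo p x h\<bar> \<le> b"
      using kap[of N]
    proof eventually_elim
      case (elim h)
      then show ?case using abs_horo_le[of p x h] by (simp add: b_def mult.commute)
    qed
    have int: "integrable (walk_law \<mu> N) (horo p x)"
      using h by (intro L.integrable_const_bound[where B = b]) auto
    have "(\<integral>\<^sup>+ h. ennreal (exp (s * e * horo p x h)) \<partial>walk_law \<mu> N)
        \<le> (\<integral>\<^sup>+ h. ennreal (1 + s * e * horo p x h + 2 * (s * b)\<^sup>2) \<partial>walk_law \<mu> N)"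
    proof (rule nn_integral_mono_AE)
      show "AE h in walk_law \<mu> N. ennreal (exp (s * e * horo p x h)) \<le> ennreal (1 + s * e * horo p x h + 2 * (s * b)\<^sup>2)"
        using u
      proof eventually_elim
        case (elim h)
        have "exp (s * e * horo p x h) \<le> 1 + s * e * horo p x h + 2 * (s * e * horo p x h)\<^sup>2"
          using elim s(2) by (intro exp_le_quadratic) simp
        also have "(s * e * horo p x h)\<^sup>2 \<le> (s * b)\<^sup>2"
          using power_mono[OF elim abs_ge_zero, of 2] by (simp only: power2_abs)
        finally show ?case by (intro ennreal_leI) simp
      qed
    qed
    also have "\<dots> = ennreal (\<integral>h. 1 + s * e * horo p x h + 2 * (s * b)\<^sup>2 \<partial>walk_law \<mu> N)"
    proof (rule nn_integral_eq_integral)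
      show "AE h in walk_law \<mu> N. 0 \<le> 1 + s * e * horo p x h + 2 * (s * b)\<^sup>2"
        using u
      proof eventually_elim
        case (elim h)
        then have "-1 \<le> s * e * horo p x h" using s(2) by (simp add: abs_le_iff)
        then show ?case by (smt (verit) zero_le_power2)
      qed
    qed (use int in auto)
    also have "(\<integral>h. 1 + s * e * horo p x h + 2 * (s * b)\<^sup>2 \<partial>walk_law \<mu> N)
        = 1 + s * (e * (\<integral>h. horo p x h \<partial>walk_law \<mu> N)) + 2 * (s * b)\<^sup>2"
      using int L.prob_space[of N] by (simp add: mult.assoc)
    also have "\<dots> \<le> 1 + c" using w[of x] s by (simp add: c_def)
    also have "\<dots> \<le> exp c" by (rule exp_ge_add_one_self)
    finally show ?thesis by (simp add: ennreal_leI)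
  qed
  have small: "(\<integral>\<^sup>+ h. ennreal (exp (s * e * horo p x h)) \<partial>walk_law \<mu> r) \<le> ennreal (exp 1)"
    if r: "r \<le> N" for r x
  proof -
    have "AE h in walk_law \<mu> r. ennreal (exp (s * e * horo p x h)) \<le> ennreal (exp 1)"
      using kap[of r]
    proof eventually_elim
      case (elim h)
      have "s * e * horo p x h \<le> s * displacement p h" using abs_e[of x h] by simp
      also have "\<dots> \<le> s * (real r * B)" using elim s by simp
      also have "\<dots> \<le> s * b" using r B s by (simp add: b_def)
      also have "\<dots> \<le> 1" by (rule s)
      finally show ?case by (intro ennreal_leI) simp
    qed
    then have "(\<integral>\<^sup>+ h. ennreal (exp (s * e * horo p x h)) \<partial>walk_law \<mu> r) \<le> (\<integral>\<^sup>+ h. ennreal (exp 1) \<partial>walk_law \<mu> r)"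
      by (rule nn_integral_mono_AE)
    then show ?thesis using L.emeasure_space_1[of r] by simp
  qed
  have block: "(\<integral>\<^sup>+ h. ennreal (exp (s * e * horo p x h)) \<partial>walk_law \<mu> (j * N)) \<le> ennreal (exp c ^ j)" for j x
  proof (induction j arbitrary: x)
    case 0
    then show ?case by (simp add: walk_law_0 nn_integral_return horo_def)
  next
    case (Suc j)
    show ?case using exp_horo_mult[OF step Suc, where x = x] by simp
  qed
  have moment: "(\<integral>\<^sup>+ h. ennreal (exp (s * e * displacement p h)) \<partial>walk_law \<mu> n)
      \<le> ennreal (exp c ^ (n div N) * exp 1)" for n
  proof -
    have "n mod N \<le> N" using N by (simp add: less_imp_le)
    from exp_horo_mult[OF block[of "n div N"] small[OF this], where x = p]
    show ?thesis by (simp add: horo_self)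
  qed
  \<comment> \<open>The three summands pay for the moment of the incomplete last block, its share of
    the threshold, and rounding n / N down.\<close>
  define K where "K = exp (1 + s * real N * \<bar>v\<bar> + \<theta>)"
  define q where "q = exp (- \<theta> / real N)"
  have q: "0 < q" "q < 1" using \<theta> N by (auto simp: q_def)
  let ?A = "\<lambda>n. {h. real n * v \<le> e * displacement p h}"
  have prob: "emeasure (walk_law \<mu> n) (?A n) \<le> ennreal (K * q ^ n)" for n
  proof -
    define j where "j = n div N"
    have n: "n = j * N + n mod N" by (simp add: j_def)
    have "emeasure (walk_law \<mu> n) (?A n) = (\<integral>\<^sup>+ h. indicator (?A n) h \<partial>walk_law \<mu> n)" by simp
    also have "\<dots> \<le> (\<integral>\<^sup>+ h. ennreal (exp (- s * (real n * v))) * ennreal (exp (s * e * displacement p h)) \<partial>walk_law \<mu> n)"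
    proof (rule nn_integral_mono)
      fix h
      show "indicator (?A n) h \<le> ennreal (exp (- s * (real n * v))) * ennreal (exp (s * e * displacement p h))"
      proof (cases "h \<in> ?A n")
        case True
        then have "s * (real n * v) \<le> s * (e * displacement p h)" using s by simp
        then have "1 \<le> exp (- s * (real n * v)) * exp (s * e * displacement p h)"
          unfolding exp_add[symmetric] by (simp add: mult.assoc)
        then show ?thesis using True by (simp flip: ennreal_mult)
      qed simp
    qed
    also have "\<dots> = ennreal (exp (- s * (real n * v))) * (\<integral>\<^sup>+ h. ennreal (exp (s * e * displacement p h)) \<partial>walk_law \<mu> n)"
      by (rule nn_integral_cmult) measurable
    also have "\<dots> \<le> ennreal (exp (- s * (real n * v))) * ennreal (exp c ^ j * exp 1)"
      unfolding j_def by (intro mult_left_mono moment) simp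
    also have "\<dots> = ennreal (exp (1 + real j * c - s * (real n * v)))"
      by (simp add: exp_add exp_diff exp_minus field_simps flip: ennreal_mult exp_of_nat_mult)
    also have "\<dots> \<le> ennreal (K * q ^ n)"
    proof (rule ennreal_leI)
      have nr: "real n = real j * real N + real (n mod N)"
        by (subst n) simp
      have m: "real (n mod N) \<le> real N" using N by (simp add: less_imp_le)
      have "- (real (n mod N) * v) \<le> real (n mod N) * \<bar>v\<bar>" by (simp add: abs_if)
      also have "\<dots> \<le> real N * \<bar>v\<bar>" using m by (intro mult_right_mono) auto
      finally have "s * (- (real (n mod N) * v)) \<le> s * (real N * \<bar>v\<bar>)" using s by (intro mult_left_mono) auto
      then have "1 + real j * c - s * (real n * v) \<le> 1 + s * real N * \<bar>v\<bar> - real j * \<theta>"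
        by (simp add: nr \<theta>_def algebra_simps)
      also have "real n / real N - 1 \<le> real j"
        using m N by (simp add: nr field_simps)
      then have "(real n / real N - 1) * \<theta> \<le> real j * \<theta>" using \<theta> by (intro mult_right_mono) auto
      then have "1 + s * real N * \<bar>v\<bar> - real j * \<theta> \<le> (1 + s * real N * \<bar>v\<bar> + \<theta>) + real n * (- \<theta> / real N)"
        by (simp add: algebra_simps)
      finally show "exp (1 + real j * c - s * (real n * v)) \<le> K * q ^ n"
        by (simp add: K_def q_def flip: exp_of_nat_mult exp_add)
    qed
    finally show ?thesis .
  qed
  let ?X = "\<lambda>n \<omega>. prod_list (map \<omega> [0..<n])"
  let ?E = "\<lambda>n. {\<omega>\<in>space S. real n * v \<le> e * displacement p (?X n \<omega>)}"
  have E: "emeasure S (?E n) \<le> ennreal (K * q ^ n)" for n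
  proof -
    have "emeasure S (?E n) = emeasure (walk_law \<mu> n) (?A n)"
      unfolding walk_law_def
      by (subst emeasure_distr) (auto intro!: arg_cong[where f = "emeasure S"])
    then show ?thesis using prob by simp
  qed
  have "AE \<omega> in S. eventually (\<lambda>n. \<omega> \<in> space S - ?E n) sequentially"
  proof (rule borel_cantelli_AE1)
    have fin: "emeasure S (?E n) < \<infinity>" for n using le_less_trans[OF E ennreal_less_top] by simp
    then show "emeasure S (?E n) < \<infinity>" for n .
    have le: "measure S (?E n) \<le> K * q ^ n" for n
      using E[of n] q by (simp add: P.emeasure_eq_measure K_def)
    have "summable (\<lambda>n. K * q ^ n)"
      using q by (intro summable_mult summable_geometric) simp
    then show "summable (\<lambda>n. measure S (?E n))"
      by (rule summable_comparison_test'[where N = 0]) (simp add: le)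
  qed measurable
  then show ?thesis
  proof eventually_elim
    case (elim \<omega>)
    show ?case
      using elim eventually_gt_at_top[of 0]
    proof eventually_elim
      case (elim n)
      then have "e * displacement p (?X n \<omega>) < v * real n" by (auto simp: mult.commute)
      then show ?case using elim by (simp add: pos_divide_less_eq)
    qed
  qed
qed

lemma drift_eqI:
  assumes "AE \<omega> in S. (\<lambda>n. displacement p (prod_list (map \<omega> [0..<n])) / real n) \<longlonglongrightarrow> l"
  shows "drift p \<mu> = l"
  unfolding drift_def
proof (rule the_equality)
  show "AE \<omega> in S. (\<lambda>n. displacement p (prod_list (map \<omega> [0..<n])) / real n) \<longlonglongrightarrow> l" by (rule assms)
next
  fix l' assume "AE \<omega> in S. (\<lambda>n. displacement p (prod_list (map \<omega> [0..<n])) / real n) \<longlonglongrightarrow> l'"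
  with assms have "AE \<omega> in S. l' = l" by eventually_elim (rule LIMSEQ_unique)
  then show "l' = l" by simp
qed

text \<open>The two signs in \<open>eventually_displacement_less\<close> give upper and lower tail
  bounds at every dyadic scale. As \<eta> is negligible, they close up on one constant, the infimum
  of the upper bounds.\<close>

lemma drift_bounds:
  assumes B: "B > 0" "AE g in \<mu>. displacement p g \<le> B"
    and \<eta>: "(\<lambda>k. \<eta> k / 2 ^ k) \<longlonglongrightarrow> 0"
      "\<And>k x. (\<integral>h. gromov_product p x (app_isom h p) \<partial>walk_law \<mu> (2 ^ k)) \<le> \<eta> k"
  shows "drift p \<mu> \<le> (\<integral>h. displacement p h \<partial>walk_law \<mu> (2 ^ k)) / 2 ^ k"
    and "((\<integral>h. displacement p h \<partial>walk_law \<mu> (2 ^ k)) - 2 * \<eta> k) / 2 ^ k \<le> drift p \<mu>"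
proof -
  let ?a = "\<lambda>k. \<integral>h. displacement p h \<partial>walk_law \<mu> (2 ^ k)"
  let ?Y = "\<lambda>\<omega> n. displacement p (prod_list (map \<omega> [0..<n])) / real n"
  have kap: "AE h in walk_law \<mu> n. displacement p h \<le> real n * B" for n
    by (rule AE_displacement_walk_law[OF B(2)])
  have intd: "integrable (walk_law \<mu> n) (displacement p)" for n
    using kap[of n] by (intro L.integrable_const_bound[where B = "real n * B"]) auto
  have horo: "(\<integral>h. horo p x h \<partial>walk_law \<mu> n) = (\<integral>h. displacement p h \<partial>walk_law \<mu> n)
      - 2 * (\<integral>h. gromov_product p x (app_isom h p) \<partial>walk_law \<mu> n)" for x n
  proof -
    have gpm [measurable]: "(\<lambda>h. gromov_product p x (app_isom h p)) \<in> borel_measurable borel"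
      unfolding gromov_product_def dist_commute[of x] by measurable
    have "AE h in walk_law \<mu> n. norm (gromov_product p x (app_isom h p)) \<le> real n * B"
      using kap[of n]
    proof eventually_elim
      case (elim h)
      then show ?case
        using gromov_product_le(1)[of p x "app_isom h p"] gromov_product_nonneg[of p x "app_isom h p"]
        by (simp add: displacement_def)
    qed
    then have "integrable (walk_law \<mu> n) (\<lambda>h. gromov_product p x (app_isom h p))"
      by (intro L.integrable_const_bound[where B = "real n * B"]) auto
    then show ?thesis using intd[of n] by (simp add: horo_eq)
  qed
  \<comment> \<open>Slacks \<open>1 / Suc i\<close> leave only countably many exceptional null sets.
    The upper mean is the one for displacement since Gromov products are nonnegative.\<close>
  have up: "AE \<omega> in S. eventually (\<lambda>n. 1 * ?Y \<omega> n < ?a k / 2 ^ k + 1 / real (Suc i)) sequentially" for k i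
  proof (rule eventually_displacement_less[where N = "2 ^ k" and w = "?a k"])
    show "1 * (\<integral>h. horo p x h \<partial>walk_law \<mu> (2 ^ k)) \<le> ?a k" for x
      unfolding horo by (simp add: gromov_product_nonneg)
  qed (use B in auto)
  have low: "AE \<omega> in S. eventually (\<lambda>n. - 1 * ?Y \<omega> n < - (?a k - 2 * \<eta> k) / 2 ^ k + 1 / real (Suc i)) sequentially" for k i
  proof (rule eventually_displacement_less[where N = "2 ^ k" and w = "- (?a k - 2 * \<eta> k)"])
    show "- 1 * (\<integral>h. horo p x h \<partial>walk_law \<mu> (2 ^ k)) \<le> - (?a k - 2 * \<eta> k)" for x
      unfolding horo using \<eta>(2)[of k x] by simp
  qed (use B in auto)
  have bdd: "bdd_below (range (\<lambda>k. ?a k / 2 ^ k))"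
    by (intro bdd_belowI[of _ 0]) (auto intro!: divide_nonneg_nonneg integral_nonneg)
  define l where "l = (INF k. ?a k / 2 ^ k)"
  have l_le: "l \<le> ?a k / 2 ^ k" for k
    unfolding l_def by (rule cINF_lower[OF bdd]) simp
  have AE: "AE \<omega> in S. \<forall>k i. eventually (\<lambda>n. ?Y \<omega> n < ?a k / 2 ^ k + 1 / real (Suc i)) sequentially \<and>
      eventually (\<lambda>n. (?a k - 2 * \<eta> k) / 2 ^ k - 1 / real (Suc i) < ?Y \<omega> n) sequentially"
    unfolding AE_all_countable
  proof (intro allI)
    fix k i
    show "AE \<omega> in S. eventually (\<lambda>n. ?Y \<omega> n < ?a k / 2 ^ k + 1 / real (Suc i)) sequentially \<and>
      eventually (\<lambda>n. (?a k - 2 * \<eta> k) / 2 ^ k - 1 / real (Suc i) < ?Y \<omega> n) sequentially"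
      using up[of k i] low[of k i]
    proof eventually_elim
      case (elim \<omega>)
      have "eventually (\<lambda>n. (?a k - 2 * \<eta> k) / 2 ^ k - 1 / real (Suc i) < ?Y \<omega> n) sequentially"
        using elim(2)
      proof eventually_elim
        case (elim n)
        have "- (?a k - 2 * \<eta> k) / 2 ^ k = - ((?a k - 2 * \<eta> k) / 2 ^ k)" by (rule minus_divide_left[symmetric])
        then show ?case using elim by linarith
      qed
      then show ?case using elim(1) by simp
    qed
  qed
  have lim: "?Y \<omega> \<longlonglongrightarrow> l"
    if \<omega>: "\<forall>k i. eventually (\<lambda>n. ?Y \<omega> n < ?a k / 2 ^ k + 1 / real (Suc i)) sequentially \<and>
      eventually (\<lambda>n. (?a k - 2 * \<eta> k) / 2 ^ k - 1 / real (Suc i) < ?Y \<omega> n) sequentially" for \<omega>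
  proof (rule order_tendstoI)
    fix u assume "l < u"
    then obtain k where k: "?a k / 2 ^ k < u"
      unfolding l_def using cINF_less_iff[OF _ bdd] by auto
    then obtain i where i: "1 / real (Suc i) < u - ?a k / 2 ^ k"
      using nat_approx_posE[of "u - ?a k / 2 ^ k"] by auto
    have "eventually (\<lambda>n. ?Y \<omega> n < ?a k / 2 ^ k + 1 / real (Suc i)) sequentially" using \<omega> by blast
    then show "eventually (\<lambda>n. ?Y \<omega> n < u) sequentially"
      by eventually_elim (use i in linarith)
  next
    fix u assume u: "u < l"
    obtain i where i: "1 / real (Suc i) < (l - u) / 2"
      using nat_approx_posE[of "(l - u) / 2"] u by auto
    have "eventually (\<lambda>k. \<eta> k / 2 ^ k < (l - u) / 4) sequentially"
      using \<eta>(1) u by (intro order_tendstoD(2)) auto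
    then obtain k where k: "\<eta> k / 2 ^ k < (l - u) / 4" by (auto simp: eventually_sequentially)
    define y where "y = \<eta> k / 2 ^ k"
    have "(?a k - 2 * \<eta> k) / 2 ^ k = ?a k / 2 ^ k - 2 * y" by (simp add: diff_divide_distrib y_def)
    moreover have "y < (l - u) / 4" using k unfolding y_def .
    ultimately have *: "u < (?a k - 2 * \<eta> k) / 2 ^ k - 1 / real (Suc i)"
      using l_le[of k] i by argo
    have "eventually (\<lambda>n. (?a k - 2 * \<eta> k) / 2 ^ k - 1 / real (Suc i) < ?Y \<omega> n) sequentially" using \<omega> by blast
    then show "eventually (\<lambda>n. u < ?Y \<omega> n) sequentially"
      by eventually_elim (use * in linarith)
  qed
  have dl: "drift p \<mu> = l"
    by (rule drift_eqI) (use AE in eventually_elim, rule lim)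
  show "drift p \<mu> \<le> ?a k / 2 ^ k" unfolding dl by (rule l_le)
  \<comment> \<open>A deterministic inequality read off from one typical trajectory: on a
    probability space an almost sure constant statement is true.\<close>
  have "AE \<omega> in S. (?a k - 2 * \<eta> k) / 2 ^ k \<le> l"
    using AE
  proof eventually_elim
    case (elim \<omega>)
    show ?case
    proof (rule field_le_epsilon)
      fix \<epsilon> :: real assume "\<epsilon> > 0"
      then obtain i where i: "1 / real (Suc i) < \<epsilon>" by (rule nat_approx_posE)
      have "eventually (\<lambda>n. (?a k - 2 * \<eta> k) / 2 ^ k - 1 / real (Suc i) < ?Y \<omega> n) sequentially" using elim by blast
      then have "eventually (\<lambda>n. (?a k - 2 * \<eta> k) / 2 ^ k - 1 / real (Suc i) \<le> ?Y \<omega> n) sequentially"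
        by eventually_elim simp
      from tendsto_lowerbound[OF lim[OF elim] this] i
      show "(?a k - 2 * \<eta> k) / 2 ^ k \<le> l + \<epsilon>" by simp
    qed
  qed
  then show "(?a k - 2 * \<eta> k) / 2 ^ k \<le> drift p \<mu>" unfolding dl by simp
qed

end

section \<open>Weak limits\<close>

text \<open>The complement of the support is covered by null open sets; the countable base reduces
  these to countably many null basic sets. This turns bounds on the support into almost sure
  bounds.\<close>

lemma AE_measure_support:
  fixes \<mu> :: "'a::metric_space isom measure"
  assumes pm: "proper_metric TYPE('a)" and bp: "borel_prob \<mu>"
  shows "AE g in \<mu>. g \<in> measure_support \<mu>"
proof -
  obtain D :: "'a set" where D: "countable D" "\<And>x e. e > 0 \<Longrightarrow> \<exists>z\<in>D. dist x z < e"
    using proper_countable_dense[OF pm] by metis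
  define I where "I = {L \<in> lists (D \<times> D \<times> (\<rat> :: real set)). emeasure \<mu> (isom_base L) = 0}"
  have I: "countable I"
    unfolding I_def by (rule countable_subset[OF _ countable_isom_base_lists[OF D(1)]]) blast
  have "isom_base L \<in> null_sets \<mu>" if "L \<in> I" for L
    using that open_isom_base[of L] borel_probD(2)[OF bp] by (auto simp: I_def null_sets_def)
  then have null: "(\<Union>L\<in>I. isom_base L) \<in> null_sets \<mu>"
    using I by (intro null_sets_UN') auto
  have "- measure_support \<mu> \<subseteq> (\<Union>L\<in>I. isom_base L)"
  proof
    fix g assume "g \<in> - measure_support \<mu>"
    then obtain U where U: "open U" "g \<in> U" "emeasure \<mu> U = 0"
      by (auto simp: measure_support_def)
    have "g \<in> (\<Union>L\<in>{L \<in> lists (D \<times> D \<times> \<rat>). isom_base L \<subseteq> U}. isom_base L)"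
      using open_isom_eq_UN_base[OF D(2) U(1)] U(2) by blast
    then obtain L where L: "L \<in> lists (D \<times> D \<times> \<rat>)" "isom_base L \<subseteq> U" "g \<in> isom_base L" by blast
    have "emeasure \<mu> (isom_base L) \<le> emeasure \<mu> U"
      using L(2) U(1) borel_probD(2)[OF bp] by (intro emeasure_mono) auto
    then have "L \<in> I" using L(1) U(3) by (simp add: I_def)
    then show "g \<in> (\<Union>L\<in>I. isom_base L)" using L(3) by blast
  qed
  with null show ?thesis by (intro AE_I'[of _ \<mu>]) auto
qed

lemma AE_displacement_le_weak_limit:
  fixes \<mu> :: "nat \<Rightarrow> 'a::metric_space isom measure"
  assumes bp: "\<And>m. borel_prob (\<mu> m)" "borel_prob \<mu>'" and weak: "weakly_converges \<mu> \<mu>'"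
    and B: "\<And>m. AE g in \<mu> m. displacement p g \<le> B"
  shows "AE g in \<mu>'. displacement p g \<le> B"
proof -
  interpret M': prob_space \<mu>' by (rule borel_probD[OF bp(2)])
  note [measurable_cong] = borel_probD(2)[OF bp(2)]
  \<comment> \<open>A bounded continuous test function vanishing exactly where the displacement is
    at most \<open>B\<close>.\<close>
  define f where "f g = min 1 (max 0 (displacement p g - B))" for g
  have f01: "0 \<le> f g" "f g \<le> 1" for g by (auto simp: f_def)
  have cont: "continuous_on UNIV f"
    unfolding f_def displacement_def by (intro continuous_intros)
  have "bounded (range f)" using f01 by (intro boundedI[of _ 1]) auto
  then have "(\<lambda>m. integral\<^sup>L (\<mu> m) f) \<longlonglongrightarrow> integral\<^sup>L \<mu>' f"
    using weak cont by (auto simp: weakly_converges_def)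
  moreover have "integral\<^sup>L (\<mu> m) f = 0" for m
  proof -
    have "AE g in \<mu> m. f g = 0" using B[of m] by eventually_elim (simp add: f_def)
    then show ?thesis by (rule integral_eq_zero_AE)
  qed
  ultimately have "integral\<^sup>L \<mu>' f = 0" by (simp add: LIMSEQ_const_iff)
  moreover have [measurable]: "f \<in> borel_measurable borel"
    using cont by (rule borel_measurable_continuous_onI)
  have "integrable \<mu>' f"
    using f01 by (intro M'.integrable_const_bound[where B = 1]) auto
  ultimately have "AE g in \<mu>'. f g = 0"
    using f01 by (subst (asm) integral_nonneg_eq_0_iff_AE) auto
  then show ?thesis by eventually_elim (auto simp: f_def min_def max_def split: if_splits)
qed

section \<open>Weak convergence of Markov averages at a fixed time\<close>

lemma uniform_on_compact_of_lipschitz: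
  fixes f :: "nat \<Rightarrow> 'a::metric_space \<Rightarrow> real"
  assumes f: "\<And>m x y. \<bar>f m x - f m y\<bar> \<le> dist x y" and g: "\<And>x y. \<bar>g x - g y\<bar> \<le> dist x y"
    and lim: "\<And>x. (\<lambda>m. f m x) \<longlonglongrightarrow> g x" and C: "compact C" and e: "e > 0"
  shows "eventually (\<lambda>m. \<forall>x\<in>C. \<bar>f m x - g x\<bar> < e) sequentially"
proof -
  obtain F where F: "finite F" "C \<subseteq> (\<Union>x\<in>F. ball x (e/3))"
    using compact_eq_totally_bounded[THEN iffD1, OF C, THEN conjunct2, rule_format, of "e/3"] e
    by auto
  have "eventually (\<lambda>m. \<forall>x\<in>F. \<bar>f m x - g x\<bar> < e/3) sequentially"
  proof (intro eventually_ball_finite F(1) ballI)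
    fix x
    show "eventually (\<lambda>m. \<bar>f m x - g x\<bar> < e/3) sequentially"
      using tendstoD[OF lim, of "e/3" x] e by (simp add: dist_real_def)
  qed
  then show ?thesis
  proof eventually_elim
    case (elim m)
    show ?case
    proof
      fix x assume "x \<in> C"
      then obtain y where y: "y \<in> F" "dist y x < e/3" using F by auto
      have "\<bar>f m y - g y\<bar> < e/3" using elim y by blast
      then show "\<bar>f m x - g x\<bar> < e" using f[of m x y] g[of x y] y(2) unfolding dist_commute[of y] by argo
    qed
  qed
qed

context isom_walk
begin

lemma lipschitz_app_measurable:
  fixes u :: "'a \<Rightarrow> real"
  assumes u1: "\<And>x y. \<bar>u x - u y\<bar> \<le> dist x y"
  shows "(\<lambda>h. u (app_isom h z)) \<in> borel_measurable borel"
proof (rule borel_measurable_continuous_onI)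
  have "1-lipschitz_on UNIV u"
    using u1 by (intro lipschitz_onI) (auto simp: dist_real_def)
  then have "continuous_on UNIV u" by (rule lipschitz_on_continuous_on)
  then show "continuous_on UNIV (\<lambda>h. u (app_isom h z))"
    by (rule continuous_on_compose2[OF _ continuous_on_app_isom]) simp
qed

lemma lipschitz_app_le:
  fixes u :: "'a \<Rightarrow> real"
  assumes u1: "\<And>x y. \<bar>u x - u y\<bar> \<le> dist x y"
  shows "u (app_isom h z) \<le> u p + dist z p + displacement p h"
proof -
  have "dist (app_isom h z) p \<le> dist z p + displacement p h"
    using dist_triangle[of "app_isom h z" p "app_isom h p"] by (simp add: displacement_def)
  then show ?thesis using u1[of "app_isom h z" p] by simp
qed

lemma integrable_lipschitz_app:
  fixes u :: "'a \<Rightarrow> real"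
  assumes u0: "\<And>x. 0 \<le> u x" and u1: "\<And>x y. \<bar>u x - u y\<bar> \<le> dist x y"
    and B: "AE g in \<mu>. displacement p g \<le> B"
  shows "integrable (walk_law \<mu> n) (\<lambda>h. u (app_isom h z))"
proof (rule L.integrable_const_bound)
  show "AE h in walk_law \<mu> n. norm (u (app_isom h z)) \<le> u p + dist z p + real n * B"
    using AE_displacement_walk_law[OF B, of n]
  proof eventually_elim
    case (elim h)
    then show ?case using lipschitz_app_le[OF u1, of h z p] u0[of "app_isom h z"] by simp
  qed
qed (use lipschitz_app_measurable[OF u1] in simp)

lemma lipschitz_walk_average:
  fixes u :: "'a \<Rightarrow> real"
  assumes u0: "\<And>x. 0 \<le> u x" and u1: "\<And>x y. \<bar>u x - u y\<bar> \<le> dist x y"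
    and B: "AE g in \<mu>. displacement p g \<le> B"
  shows "\<bar>(\<integral>h. u (app_isom h x) \<partial>walk_law \<mu> n) - (\<integral>h. u (app_isom h y) \<partial>walk_law \<mu> n)\<bar> \<le> dist x y"
proof -
  note int = integrable_lipschitz_app[OF u0 u1 B]
  have "\<bar>(\<integral>h. u (app_isom h x) - u (app_isom h y) \<partial>walk_law \<mu> n)\<bar>
      \<le> (\<integral>h. \<bar>u (app_isom h x) - u (app_isom h y)\<bar> \<partial>walk_law \<mu> n)"
    by (rule integral_abs_bound)
  also have "\<dots> \<le> (\<integral>h. dist x y \<partial>walk_law \<mu> n)"
    using u1[of "app_isom h x" "app_isom h y" for h]
    by (intro integral_mono integrable_abs Bochner_Integration.integrable_diff int) auto
  finally show ?thesis
    using L.prob_space[of n] by (simp add: Bochner_Integration.integral_diff int)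
qed

lemma walk_average_nonneg:
  fixes u :: "'a \<Rightarrow> real"
  assumes u0: "\<And>x. 0 \<le> u x"
  shows "0 \<le> (\<integral>h. u (app_isom h x) \<partial>walk_law \<mu> n)"
  by (intro Bochner_Integration.integral_nonneg u0)

text \<open>The last increment acts first on \<open>z\<close>. Fubini places it outermost, so that
  the outer integral is over \<mu> itself, the measure of which weak convergence speaks.\<close>

lemma walk_average_Suc:
  fixes u :: "'a \<Rightarrow> real"
  assumes u0: "\<And>x. 0 \<le> u x" and u1: "\<And>x y. \<bar>u x - u y\<bar> \<le> dist x y"
    and B: "AE g in \<mu>. displacement p g \<le> B"
  shows "(\<integral>h. u (app_isom h z) \<partial>walk_law \<mu> (Suc n))
    = (\<integral>g. (\<integral>h. u (app_isom h (app_isom g z)) \<partial>walk_law \<mu> n) \<partial>\<mu>)"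
proof -
  let ?U = "\<lambda>y. \<integral>h. u (app_isom h y) \<partial>walk_law \<mu> n"
  note int = integrable_lipschitz_app[OF u0 u1 B]
  have U: "0 \<le> ?U x" "\<bar>?U x - ?U y\<bar> \<le> dist x y" for x y
    by (rule walk_average_nonneg[where u = u, OF u0], rule lipschitz_walk_average[OF u0 u1 B])
  have [measurable]: "(\<lambda>h. u (app_isom h z)) \<in> borel_measurable borel"
    by (rule lipschitz_app_measurable[OF u1])
  interpret pair_sigma_finite "walk_law \<mu> n" \<mu> ..
  have "ennreal (\<integral>h. u (app_isom h z) \<partial>walk_law \<mu> (Suc n)) = (\<integral>\<^sup>+ h. ennreal (u (app_isom h z)) \<partial>walk_law \<mu> (n + Suc 0))"
    using nn_integral_eq_integral[OF int] u0 by simp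
  also have "\<dots> = (\<integral>\<^sup>+ h. (\<integral>\<^sup>+ g. ennreal (u (app_isom (h * g) z)) \<partial>\<mu>) \<partial>walk_law \<mu> n)"
    by (subst nn_integral_walk_law_add) (simp_all only: walk_law_1, measurable)
  also have "\<dots> = (\<integral>\<^sup>+ g. (\<integral>\<^sup>+ h. ennreal (u (app_isom (h * g) z)) \<partial>walk_law \<mu> n) \<partial>\<mu>)"
  proof (rule Fubini'[symmetric])
    have "(\<lambda>w. u (app_isom (fst w * snd w) z)) \<in> borel_measurable (walk_law \<mu> n \<Otimes>\<^sub>M \<mu>)"
      by (rule measurable_compose[OF _ lipschitz_app_measurable[OF u1]]) measurable
    then show "(\<lambda>(h, g). ennreal (u (app_isom (h * g) z))) \<in> borel_measurable (walk_law \<mu> n \<Otimes>\<^sub>M \<mu>)"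
      unfolding case_prod_unfold by measurable
  qed
  also have "\<dots> = (\<integral>\<^sup>+ g. ennreal (?U (app_isom g z)) \<partial>\<mu>)"
    using nn_integral_eq_integral[OF int] u0 by simp
  also have "\<dots> = ennreal (\<integral>g. ?U (app_isom g z) \<partial>\<mu>)"
    using integrable_lipschitz_app[OF U B, where n = "Suc 0" and z = z] U(1)
    by (intro nn_integral_eq_integral) (simp_all add: walk_law_1)
  finally show ?thesis
    using walk_average_nonneg[where u = u, OF u0] U(1) by (subst (asm) ennreal_inj) (auto intro: Bochner_Integration.integral_nonneg)
qed

end

text \<open>In the induction step both the measure and the integrand vary. Replacing the integrand
  by its limit \<open>V\<close> costs little because convergence of 1-Lipschitz functions is uniform
  on the ball containing almost all images of \<open>z\<close>; for fixed \<open>V\<close> weak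
  convergence applies.\<close>

lemma walk_average_tendsto:
  fixes \<mu> :: "nat \<Rightarrow> 'a::metric_space isom measure" and u :: "'a \<Rightarrow> real"
  assumes pm: "proper_metric TYPE('a)" and bp: "\<And>m. borel_prob (\<mu> m)" "borel_prob \<mu>'"
    and weak: "weakly_converges \<mu> \<mu>'"
    and B: "\<And>m. AE g in \<mu> m. displacement p g \<le> B" "AE g in \<mu>'. displacement p g \<le> B"
    and u0: "\<And>x. 0 \<le> u x" and u1: "\<And>x y. \<bar>u x - u y\<bar> \<le> dist x y"
  shows "(\<lambda>m. \<integral>h. u (app_isom h z) \<partial>walk_law (\<mu> m) n) \<longlonglongrightarrow> (\<integral>h. u (app_isom h z) \<partial>walk_law \<mu>' n)"
proof (induction n arbitrary: z)
  case 0
  interpret W': isom_walk \<mu>' by unfold_locales (rule pm bp)+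
  have [measurable]: "(\<lambda>h. u (app_isom h z)) \<in> borel_measurable borel"
    by (rule W'.lipschitz_app_measurable[OF u1])
  have "walk_law (\<mu> m) 0 = return borel 1" for m
    by (rule isom_walk.walk_law_0) (unfold_locales, rule pm bp)+
  then show ?case by (simp add: W'.walk_law_0)
next
  case (Suc n)
  have W: "isom_walk (\<mu> m)" for m by unfold_locales (rule pm bp)+
  interpret W': isom_walk \<mu>' by unfold_locales (rule pm bp)+
  let ?U = "\<lambda>m y. \<integral>h. u (app_isom h y) \<partial>walk_law (\<mu> m) n"
  define V where "V y = (\<integral>h. u (app_isom h y) \<partial>walk_law \<mu>' n)" for y
  have U0: "0 \<le> ?U m y" for m y
    by (rule isom_walk.walk_average_nonneg[OF W, where u = u, OF u0])
  have U1: "\<bar>?U m x - ?U m y\<bar> \<le> dist x y" for m x y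
    by (rule isom_walk.lipschitz_walk_average[OF W u0 u1 B(1)])
  have V0: "0 \<le> V y" for y unfolding V_def by (rule W'.walk_average_nonneg[where u = u, OF u0])
  have V1: "\<bar>V x - V y\<bar> \<le> dist x y" for x y
    unfolding V_def by (rule W'.lipschitz_walk_average[OF u0 u1 B(2)])
  have UV: "(\<lambda>m. ?U m y) \<longlonglongrightarrow> V y" for y unfolding V_def by (rule Suc)
  let ?C = "cball p (dist z p + B)"
  have C: "app_isom g z \<in> ?C" if "displacement p g \<le> B" for g
    using that dist_triangle[of "app_isom g z" p "app_isom g p"]
    by (simp add: displacement_def dist_commute)
  have Vint: "integrable (\<mu> m) (\<lambda>g. V (app_isom g z))" for m
    using isom_walk.integrable_lipschitz_app[OF W V0 V1 B(1), where n = "Suc 0" and z = z]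
    by (simp add: isom_walk.walk_law_1[OF W])
  have Uint: "integrable (\<mu> m) (\<lambda>g. ?U m (app_isom g z))" for m
    using isom_walk.integrable_lipschitz_app[OF W U0 U1 B(1), where n = "Suc 0" and z = z]
    by (simp add: isom_walk.walk_law_1[OF W])
  have weakV: "(\<lambda>m. \<integral>g. V (app_isom g z) \<partial>\<mu> m) \<longlonglongrightarrow> (\<integral>g. V (app_isom g z) \<partial>\<mu>')"
  proof -
    \<comment> \<open>\<open>V\<close> may be unbounded, so it is truncated at a level that is
      almost surely not exceeded under any of the measures.\<close>
    define K where "K = V p + dist z p + B"
    define f where "f g = min (V (app_isom g z)) K" for g
    have contV: "continuous_on UNIV V"
      using V1 by (intro lipschitz_on_continuous_on[of 1] lipschitz_onI) (auto simp: dist_real_def)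
    have cont: "continuous_on UNIV f"
      unfolding f_def
      by (intro continuous_intros continuous_on_compose2[OF contV continuous_on_app_isom]) auto
    have "\<bar>f g\<bar> \<le> \<bar>K\<bar>" for g
      using V0[of "app_isom g z"] unfolding f_def by linarith
    then have "bounded (range f)" by (intro boundedI[of _ "\<bar>K\<bar>"]) auto
    then have "(\<lambda>m. integral\<^sup>L (\<mu> m) f) \<longlonglongrightarrow> integral\<^sup>L \<mu>' f"
      using weak cont by (auto simp: weakly_converges_def)
    moreover have fV: "f g = V (app_isom g z)" if "displacement p g \<le> B" for g
      using W'.lipschitz_app_le[OF V1, of g z p] that by (simp add: f_def K_def min_def)
    have eqf: "integral\<^sup>L M f = (\<integral>g. V (app_isom g z) \<partial>M)"
      if "borel_prob M" "AE g in M. displacement p g \<le> B" for M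
    proof (rule integral_cong_AE)
      have [measurable]: "f \<in> borel_measurable borel" "(\<lambda>g. V (app_isom g z)) \<in> borel_measurable borel"
        using cont W'.lipschitz_app_measurable[OF V1] by (auto intro: borel_measurable_continuous_onI)
      note [measurable_cong] = borel_probD(2)[OF that(1)]
      show "f \<in> borel_measurable M" "(\<lambda>g. V (app_isom g z)) \<in> borel_measurable M" by measurable
      show "AE g in M. f g = V (app_isom g z)" using that(2) by eventually_elim (rule fV)
    qed
    ultimately show ?thesis using eqf[OF bp(1) B(1)] eqf[OF bp(2) B(2)] by simp
  qed
  have diff: "(\<lambda>m. (\<integral>g. ?U m (app_isom g z) \<partial>\<mu> m) - (\<integral>g. V (app_isom g z) \<partial>\<mu> m)) \<longlonglongrightarrow> 0"
  proof (rule tendstoI)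
    fix e :: real assume "e > 0"
    then have "e / 2 > 0" by simp
    have "compact ?C" using pm by (simp add: proper_metric_def)
    from uniform_on_compact_of_lipschitz[OF U1 V1 UV this \<open>e / 2 > 0\<close>]
    show "eventually (\<lambda>m. dist ((\<integral>g. ?U m (app_isom g z) \<partial>\<mu> m) - (\<integral>g. V (app_isom g z) \<partial>\<mu> m)) 0 < e) sequentially"
    proof eventually_elim
      case (elim m)
      interpret M: prob_space "\<mu> m" by (rule borel_probD[OF bp(1)])
      have "\<bar>\<integral>g. ?U m (app_isom g z) - V (app_isom g z) \<partial>\<mu> m\<bar>
          \<le> (\<integral>g. \<bar>?U m (app_isom g z) - V (app_isom g z)\<bar> \<partial>\<mu> m)"
        by (rule integral_abs_bound)
      also have "\<dots> \<le> (\<integral>g. e / 2 \<partial>\<mu> m)"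
      proof (rule integral_mono_AE)
        show "AE g in \<mu> m. \<bar>?U m (app_isom g z) - V (app_isom g z)\<bar> \<le> e / 2"
          using B(1)[of m]
        proof eventually_elim
          case (elim g)
          have "app_isom g z \<in> ?C" by (rule C[OF elim])
          then have "\<bar>?U m (app_isom g z) - V (app_isom g z)\<bar> < e / 2"
            using \<open>\<forall>x\<in>?C. \<bar>?U m x - V x\<bar> < e / 2\<close> by blast
          then show ?case by simp
        qed
      qed (intro integrable_abs Bochner_Integration.integrable_diff Uint Vint M.integrable_const)+
      also have "\<dots> < e" using \<open>e > 0\<close> by (simp add: M.prob_space)
      finally show ?case using Uint Vint by (simp add: dist_real_def Bochner_Integration.integral_diff)
    qed
  qed
  have "(\<lambda>m. \<integral>g. ?U m (app_isom g z) \<partial>\<mu> m) \<longlonglongrightarrow> (\<integral>g. V (app_isom g z) \<partial>\<mu>')"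
    using tendsto_add[OF diff weakV] by simp
  then show ?case
    unfolding isom_walk.walk_average_Suc[OF W u0 u1 B(1)] W'.walk_average_Suc[OF u0 u1 B(2)] V_def .
qed

text \<open>Ensures that the real infimum over \<open>r\<close> is taken over a set bounded below,
  so that an infimum below a number yields an actual witness \<open>r\<close>.\<close>

lemma left_regular_norm_nonneg:
  fixes \<nu> :: "'a::metric_space isom measure"
  assumes "proper_metric TYPE('a)" "left_haar_measure \<nu>" "borel_prob m"
  shows "0 \<le> left_regular_norm \<nu> m"
proof -
  interpret haar_isom \<nu> undefined by unfold_locales (rule assms)+
  have "0 \<le> L2_norm \<nu> (left_regular_measure m (\<lambda>_. 0))" by (rule L2_norm_nonneg)
  also have "\<dots> \<le> left_regular_norm \<nu> m"
    by (rule L2_norm_left_regular_le[OF assms(3)]) (simp_all add: square_integrable_def L2_norm_def)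
  finally show ?thesis .
qed

theorem corollary4p11:
  fixes p :: "'a::metric_space"
    and \<nu> :: "'a isom measure"
    and \<mu> :: "nat \<Rightarrow> 'a isom measure"
    and \<mu>_inf :: "'a isom measure"
  assumes "proper_metric TYPE('a)"
    and "geodesic_metric TYPE('a)"
    and "gromov_hyperbolic TYPE('a)"
    and "isom_cocompact TYPE('a)"
    and "left_haar_measure \<nu>"
    and "\<And>m. borel_prob (\<mu> m)"
    and "\<And>m. non_elementary p (\<mu> m)"
    and "\<And>m. displacement_sup p (measure_support (\<mu> m)) < \<infinity>"
    and "limsup (\<lambda>m. ereal (INF r\<in>{0..<1}. left_regular_norm \<nu> (lazy r (\<mu> m)))) < 1"
    and "(SUP m. displacement_sup p (measure_support (\<mu> m))) < \<infinity>"
    and "borel_prob \<mu>_inf"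
    and "weakly_converges \<mu> \<mu>_inf"
  shows "(\<lambda>m. drift p (\<mu> m)) \<longlonglongrightarrow> drift p \<mu>_inf"
proof -
  note pm = assms(1) and bp = assms(6) and bp' = assms(11)
  interpret haar_isom \<nu> p by unfold_locales (rule assms)+
  interpret W': isom_walk \<mu>_inf by unfold_locales (rule pm bp')+
  have W: "isom_walk (\<mu> m)" for m by unfold_locales (rule pm bp)+
  obtain n :: nat where n: "(SUP m. displacement_sup p (measure_support (\<mu> m))) < ereal (real n)"
    using assms(10) less_PInf_Ex_of_nat by auto
  define B where "B = real (Suc n)"
  have B0: "B > 0" by (simp add: B_def)
  have B: "AE g in \<mu> m. displacement p g \<le> B" for m
    using AE_measure_support[OF pm bp[of m]]
  proof eventually_elim
    case (elim g)
    have "ereal (displacement p g) \<le> displacement_sup p (measure_support (\<mu> m))"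
      unfolding displacement_sup_def using elim by (rule SUP_upper)
    also have "\<dots> \<le> (SUP m. displacement_sup p (measure_support (\<mu> m)))" by (rule SUP_upper) simp
    also note n
    finally show ?case by (simp add: B_def)
  qed
  have B': "AE g in \<mu>_inf. displacement p g \<le> B"
    by (rule AE_displacement_le_weak_limit[OF bp bp' assms(12) B])
  obtain \<rho>0 where \<rho>0: "limsup (\<lambda>m. ereal (INF r\<in>{0..<1}. left_regular_norm \<nu> (lazy r (\<mu> m)))) < ereal \<rho>0"
    "ereal \<rho>0 < 1"
    using ereal_dense2[OF assms(9)] by blast
  \<comment> \<open>The maximum with 1/2 makes \<rho> positive, as the logarithm of its square root
    is taken later.\<close>
  define \<rho> where "\<rho> = max \<rho>0 (1/2)"
  have \<rho>: "0 < \<rho>" "\<rho> < 1" using \<rho>0(2) by (auto simp: \<rho>_def)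
  have gap: "eventually (\<lambda>m. \<exists>r. 0 \<le> r \<and> r < 1 \<and> left_regular_norm \<nu> (lazy r (\<mu> m)) \<le> \<rho>) sequentially"
    using Limsup_lessD[OF \<rho>0(1)]
  proof eventually_elim
    case (elim m)
    have "bdd_below ((\<lambda>r. left_regular_norm \<nu> (lazy r (\<mu> m))) ` {0..<1})"
      using left_regular_norm_nonneg[OF pm haar borel_prob_lazy[OF bp[of m]]]
      by (intro bdd_belowI[of _ 0]) auto
    then obtain r where "r \<in> {0..<1}" "left_regular_norm \<nu> (lazy r (\<mu> m)) < \<rho>0"
      using elim by (auto simp: cINF_less_iff)
    then show ?case by (intro exI[of _ r]) (auto simp: \<rho>_def)
  qed
  obtain \<eta> :: "nat \<Rightarrow> real" where \<eta>: "(\<lambda>k. \<eta> k / 2 ^ k) \<longlonglongrightarrow> 0"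
    "\<And>\<mu> r k x. borel_prob \<mu> \<Longrightarrow> AE g in \<mu>. displacement p g \<le> B \<Longrightarrow> 0 \<le> r \<Longrightarrow> r < 1 \<Longrightarrow>
      left_regular_norm \<nu> (lazy r \<mu>) \<le> \<rho> \<Longrightarrow>
      (\<integral>h. gromov_product p x (app_isom h p) \<partial>walk_law \<mu> (2 ^ k)) \<le> \<eta> k"
    by (rule gromov_product_expectation[OF assms(2,4,3) B0 \<rho>]) blast
  have gp: "eventually (\<lambda>m. \<forall>k x. (\<integral>h. gromov_product p x (app_isom h p) \<partial>walk_law (\<mu> m) (2 ^ k)) \<le> \<eta> k) sequentially"
    using gap
  proof eventually_elim
    case (elim m)
    then obtain r where "0 \<le> r" "r < 1" "left_regular_norm \<nu> (lazy r (\<mu> m)) \<le> \<rho>" by blast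
    then show ?case using \<eta>(2)[OF bp B] by blast
  qed
  have u1: "\<bar>dist y x - dist z x\<bar> \<le> dist y z" for x y z :: 'a
    using dist_triangle[of y x z] dist_triangle[of z x y] by (simp add: abs_le_iff dist_commute)
  have avg: "(\<lambda>m. \<integral>h. dist (app_isom h p) x \<partial>walk_law (\<mu> m) j) \<longlonglongrightarrow> (\<integral>h. dist (app_isom h p) x \<partial>walk_law \<mu>_inf j)" for x j
    by (rule walk_average_tendsto[OF pm bp bp' assms(12) B B' _ u1]) simp
  \<comment> \<open>Mean Gromov products become combinations of averages of distance functions,
    which are 1-Lipschitz and so covered by \<open>walk_average_tendsto\<close>.\<close>
  have gp_eq: "(\<integral>h. gromov_product p x (app_isom h p) \<partial>walk_law M j)
      = (dist x p + (\<integral>h. dist (app_isom h p) p \<partial>walk_law M j) - (\<integral>h. dist (app_isom h p) x \<partial>walk_law M j)) / 2"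
    if M: "isom_walk M" "AE g in M. displacement p g \<le> B" for M x j
  proof -
    interpret M: isom_walk M by (rule M)
    have "integrable (walk_law M j) (\<lambda>h. dist (app_isom h p) x)" for x
      by (rule M.integrable_lipschitz_app[OF _ u1 M(2)]) simp
    then show ?thesis
      using M.L.prob_space[of j] by (simp add: gromov_product_def dist_commute[of x])
  qed
  have gp': "(\<integral>h. gromov_product p x (app_isom h p) \<partial>walk_law \<mu>_inf (2 ^ k)) \<le> \<eta> k" for k x
  proof (rule tendsto_upperbound)
    show "(\<lambda>m. \<integral>h. gromov_product p x (app_isom h p) \<partial>walk_law (\<mu> m) (2 ^ k))
        \<longlonglongrightarrow> (\<integral>h. gromov_product p x (app_isom h p) \<partial>walk_law \<mu>_inf (2 ^ k))"
      unfolding gp_eq[OF W B] gp_eq[OF W'.isom_walk_axioms B']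
      by (intro tendsto_intros avg) simp
    show "eventually (\<lambda>m. (\<integral>h. gromov_product p x (app_isom h p) \<partial>walk_law (\<mu> m) (2 ^ k)) \<le> \<eta> k) sequentially"
      using gp by eventually_elim blast
  qed simp
  let ?a = "\<lambda>M k. (\<integral>h. displacement p h \<partial>walk_law M (2 ^ k)) / 2 ^ k"
  have lima: "(\<lambda>m. ?a (\<mu> m) k) \<longlonglongrightarrow> ?a \<mu>_inf k" for k
    unfolding displacement_def by (intro tendsto_intros avg) simp
  have bound': "drift p \<mu>_inf \<le> ?a \<mu>_inf k" "?a \<mu>_inf k - 2 * (\<eta> k / 2 ^ k) \<le> drift p \<mu>_inf" for k
    using W'.drift_bounds[OF B0 B' \<eta>(1) gp', of k] by (simp_all add: diff_divide_distrib)
  show ?thesis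
  proof (rule tendstoI)
    fix e :: real assume e: "e > 0"
    have "eventually (\<lambda>k. \<eta> k / 2 ^ k < e / 8) sequentially"
      using \<eta>(1) e by (intro order_tendstoD(2)) auto
    \<comment> \<open>The scale \<open>k\<close> is fixed before \<open>m\<close>: the drift bounds
      lose 2 y < e/4 and the means at time \<open>2 ^ k\<close> differ by less than e/4.\<close>
    then obtain k where "\<eta> k / 2 ^ k < e / 8" by (auto simp: eventually_sequentially)
    moreover define y where "y = \<eta> k / 2 ^ k"
    ultimately have y: "y < e / 8" by simp
    have "eventually (\<lambda>m. dist (?a (\<mu> m) k) (?a \<mu>_inf k) < e / 4) sequentially"
      using e by (intro tendstoD[OF lima]) simp
    with gp show "eventually (\<lambda>m. dist (drift p (\<mu> m)) (drift p \<mu>_inf) < e) sequentially"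
    proof eventually_elim
      case (elim m)
      have "drift p (\<mu> m) \<le> ?a (\<mu> m) k" "?a (\<mu> m) k - 2 * y \<le> drift p (\<mu> m)"
        using isom_walk.drift_bounds[OF W B0 B \<eta>(1), of m k] elim(1) by (simp_all add: diff_divide_distrib y_def)
      then show ?case
        using elim(2) bound'[of k] y e unfolding dist_real_def y_def[symmetric] by argo
    qed
  qed
qed

end
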